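(* Let $I=(t_-,t_+)\subseteq\mathbb{R}$, $\kappa:I\to\mathbb{R}$ continuous, and $c(t,t_0),s(t,t_0)$ the solutions of $\ddot u+\kappa(t)u=0$ with $c(t_0,t_0)=\dot s(t_0,t_0)=1$, $s(t_0,t_0)=\dot c(t_0,t_0)=0$. On $L^2(\mathbb{R},dq)$ let $(Q\psi)(q)=q\psi(q)$, $(P\psi)(q)=-i\psi'(q)$, and let $U(t,t_0)$ be the unitary time evolution operator generated by the Hamiltonian $H(t)=\tfrac12\big(P^2+\kappa(t)Q^2\big)$ (i.e. $U(t_0,t_0)=\mathbb{I}$, $\partial_tU(t,t_0)=-iH(t)U(t,t_0)$, so that $U^{-1}(t,t_0)QU(t,t_0)=c(t,t_0)Q+s(t,t_0)P$ and $U^{-1}(t,t_0)PU(t,t_0)=\dot c(t,t_0)Q+\dot s(t,t_0)P$). Then for every Schwartz function $\psi\in\mathscr S(\mathbb{R})$, $$(U(t,t_0)\psi)(q)=\int_{\mathbb{R}}K(q,t;q_0,t_0)\psi(q_0)\,dq_0,$$ where, whenever $s(t,t_0)\neq0$, $$K(q,t;q_0,t_0)=\frac{1}{\sqrt{2\pi i}}\,s^{-1/2}(t,t_0)\exp\Big(\frac{i}{2s(t,t_0)}\big(c(t_0,t)q^2+c(t,t_0)q_0^2-2qq_0\big)\Big),$$ and, if $s(t,t_0)=0$, $$K(q,t;q_0,t_0)=c^{-1/2}(t,t_0)\exp\Big(i\frac{\dot c(t,t_0)}{2c(t,t_0)}q^2\Big)\,\delta\big(q_0-q/c(t,t_0)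\big).$$
   Context: For a solution $u(\cdot)=u(\cdot,t_0)$ of $\ddot u+\kappa u=0$ that is positive on some interval $(t_0,t_0+\varepsilon)\subset I$, and $\epsilon\in\mathbb{R}$, one defines $u^{\epsilon}(t,t_0):=\exp\big(i\epsilon\pi\,\mathfrak m(u;t,t_0)\big)|u(t)|^{\epsilon}$, where $\mathfrak m(u;t,t_0)\in\mathbb{Z}$ is the index function of $u$, with $\mathfrak m(u;t_0,t_0)=0$ and $\mathfrak m(u;t_2,t_0)-\mathfrak m(u;t_1,t_0)$ equal to the number of zeros of $u$ in $(t_1,t_2]$ for $t_1<t_2$. This defines $s^{-1/2}(t,t_0)$ and $c^{-1/2}(t,t_0)$. $\delta$ is the Dirac delta and $\sqrt{2\pi i}=\sqrt{2\pi}e^{i\pi/4}$. *)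

theory Defs
  imports "HOL-Analysis.Analysis"
begin

definition vd :: "(real \<Rightarrow> complex) \<Rightarrow> (real \<Rightarrow> complex)" where
  "vd f = (\<lambda>x. vector_derivative f (at x))"

definition schwartz :: "(real \<Rightarrow> complex) \<Rightarrow> bool" where
  "schwartz \<psi> \<longleftrightarrow>
     (\<forall>n x. (vd ^^ n) \<psi> differentiable (at x)) \<and>
     (\<forall>m n. bounded (range (\<lambda>x. complex_of_real (x ^ m) * (vd ^^ n) \<psi> x)))"

definition L2norm :: "(real \<Rightarrow> complex) \<Rightarrow> real" where
  "L2norm f = sqrt (LINT q|lborel. (cmod (f q))\<^sup>2)"

definition ham :: "(real \<Rightarrow> real) \<Rightarrow> real \<Rightarrow> (real \<Rightarrow> complex) \<Rightarrow> (real \<Rightarrow> complex)" where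
  "ham \<kappa> t \<phi> = (\<lambda>q. (1/2) * (- (vd (vd \<phi>)) q + complex_of_real (\<kappa> t * q\<^sup>2) * \<phi> q))"

text \<open>Index function m(u;t,t0): m(u;t0,t0)=0 and m(t2)-m(t1) = number of zeros in (t1,t2].\<close>
definition index_fun :: "(real \<Rightarrow> real) \<Rightarrow> real \<Rightarrow> real \<Rightarrow> int" where
  "index_fun u t t0 =
     (if t0 \<le> t then int (card {\<tau>. t0 < \<tau> \<and> \<tau> \<le> t \<and> u \<tau> = 0})
      else - int (card {\<tau>. t < \<tau> \<and> \<tau> \<le> t0 \<and> u \<tau> = 0}))"

definition index_pow :: "(real \<Rightarrow> real) \<Rightarrow> real \<Rightarrow> real \<Rightarrow> real \<Rightarrow> complex" where
  "index_pow u eps t t0 =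
     cis (eps * pi * real_of_int (index_fun u t t0)) * complex_of_real (\<bar>u t\<bar> powr eps)"

end

theory Submission
  imports Defs "HOL-Probability.Sinc_Integral" "HOL-Real_Asymp.Real_Asymp"
begin

text \<open>
  Pair the evolved state with the conjugate of an explicit Gaussian solution of the Schroedinger
  equation that at time \<open>t\<close> is concentrated at the point \<open>a\<close> with width \<open>sqrt \<epsilon>\<close>. Since the
  Hamiltonian is symmetric, the pairing does not depend on time. As \<open>\<epsilon> \<rightarrow> 0\<close> its value at time \<open>t\<close>
  tends to a multiple of \<open>U t t0 \<psi> a\<close>, while at time \<open>t0\<close> the Gaussian tends to the kernel
  \<open>K(a,t;\<cdot>,t0)\<close>, boundedly if \<open>s(t,t0) \<noteq> 0\<close> and as a multiple of an approximate identity otherwise.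

  The prefactor of the Gaussian is \<open>Z\<^bsup>-1/2\<^esup>\<close> for a nowhere vanishing complex solution \<open>Z\<close> of the
  oscillator equation. Its continuous branch is followed with the Pruefer angle
  \<open>\<theta> = arg (c + \<i> s)\<close>, whose multiples of \<open>\<pi>\<close> (shifted by \<open>\<pi>/2\<close>) are the zeros of \<open>s\<close> (of \<open>c\<close>),
  and this yields the index.
\<close>

section \<open>Schwartz functions and decay\<close>

text \<open>The propagator is known only through an \<open>L2norm\<close> derivative on Schwartz
  states, so neither its pointwise values nor an equation for its kernel is directly accessible.
  Pairing with an exact solution turns this weak information into a conserved scalar, and only then
  is a limit taken. The kernel itself would not serve as the partner: it is not square integrable in
  \<open>q\<close>, so the \<open>L2norm\<close> remainder could not be controlled, and it is
  singular at every zero of the underlying real solution between the two times. A width \<epsilon> >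
  0 cures both: an imaginary multiple of an independent solution is added to the denominator
  \<open>Z\<close>, which then never vanishes, and all zeros are passed at once, without composing
  short-time kernels. What remains is the branch of a square root. It is anchored at
  \<open>t\<close>, where \<open>Z\<close> is \<open>- \<i> * \<epsilon>\<close> and its root has
  argument -pi/4; this is the source of the factor sqrt(2 pi i). The argument of the root at
  \<open>t0\<close>, which tends to a multiple of pi/2 when s(t,t0) is nonzero, produces the index
  phase.\<close>

lemma schwartz_vd: "schwartz f \<Longrightarrow> schwartz (vd f)"
  unfolding schwartz_def funpow_swap1[symmetric]
  by (metis funpow.simps(2) o_apply)

lemma schwartz_has_vector_derivative:
  assumes "schwartz f"
  shows "(f has_vector_derivative vd f x) (at x)"
proof -
  have "((vd ^^ 0) f) differentiable (at x)"
    using assms unfolding schwartz_def by blast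
  then show ?thesis
    by (simp add: vd_def vector_derivative_works)
qed

lemma schwartz_continuous: "schwartz f \<Longrightarrow> continuous_on UNIV f"
  using schwartz_has_vector_derivative
  by (meson continuous_at_imp_continuous_on has_vector_derivative_continuous)

lemma schwartz_power_bounded:
  assumes "schwartz f"
  obtains M where "\<And>x. \<bar>x\<bar> ^ m * cmod (f x) \<le> M"
proof -
  have "bounded (range (\<lambda>x. complex_of_real (x ^ m) * (vd ^^ 0) f x))"
    using assms unfolding schwartz_def by blast
  then obtain M where "\<And>x. cmod (complex_of_real (x ^ m) * f x) \<le> M"
    by (auto simp: bounded_iff)
  then have "\<bar>x\<bar> ^ m * cmod (f x) \<le> M" for x
    by (simp add: norm_mult norm_power)
  then show thesis using that by blast
qed

text \<open>A class made for integration: the weight bounds the function by a multiple of the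
  integrable \<open>1 / (1 + x\<^sup>2)\<close>, and also forces it to vanish at infinity. Unlike
  the Schwartz class it is stable under multiplication by any bounded continuous function, so a
  product of a Gaussian with a Schwartz function needs no control of derivatives.\<close>

definition fast_decay :: "(real \<Rightarrow> complex) \<Rightarrow> bool" where
  "fast_decay g \<longleftrightarrow> continuous_on UNIV g \<and> (\<exists>M. \<forall>x. (1 + x\<^sup>2) * cmod (g x) \<le> M)"

lemma schwartz_power_fast_decay:
  assumes "schwartz f"
  shows "fast_decay (\<lambda>x. complex_of_real x ^ m * f x)"
proof -
  obtain M1 where M1: "\<And>x. \<bar>x\<bar> ^ m * cmod (f x) \<le> M1"
    using schwartz_power_bounded[OF assms] by blast
  obtain M2 where M2: "\<And>x. \<bar>x\<bar> ^ (m+2) * cmod (f x) \<le> M2"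
    using schwartz_power_bounded[OF assms] by blast
  have "(1 + x\<^sup>2) * cmod (complex_of_real x ^ m * f x) \<le> M1 + M2" for x
  proof -
    have eq: "\<bar>x\<bar> ^ (m+2) = \<bar>x\<bar> ^ m * x\<^sup>2"
      by (simp add: power_add power2_eq_square)
    show ?thesis
      using M1[of x] M2[of x, unfolded eq] by (simp add: norm_mult norm_power algebra_simps)
  qed
  then show ?thesis
    unfolding fast_decay_def
    using schwartz_continuous[OF assms] by (auto intro!: continuous_intros)
qed

lemma schwartz_fast_decay: "schwartz f \<Longrightarrow> fast_decay f"
  using schwartz_power_fast_decay[of f 0] by simp

lemma fast_decay_add:
  assumes "fast_decay f" "fast_decay g"
  shows "fast_decay (\<lambda>x. f x + g x)"
proof -
  obtain M1 M2 where M: "\<And>x. (1 + x\<^sup>2) * cmod (f x) \<le> M1" "\<And>x. (1 + x\<^sup>2) * cmod (g x) \<le> M2"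
    using assms by (auto simp: fast_decay_def)
  have "(1 + x\<^sup>2) * cmod (f x + g x) \<le> M1 + M2" for x
  proof -
    have "(1 + x\<^sup>2) * cmod (f x + g x) \<le> (1 + x\<^sup>2) * (cmod (f x) + cmod (g x))"
      by (intro mult_left_mono norm_triangle_ineq) simp
    then show ?thesis using M[of x] by (simp add: distrib_left)
  qed
  then show ?thesis
    using assms unfolding fast_decay_def by (auto intro!: continuous_intros)
qed

lemma fast_decay_bounded_mult:
  assumes "fast_decay f" "continuous_on UNIV k" "\<And>x. cmod (k x) \<le> B"
  shows "fast_decay (\<lambda>x. k x * f x)"
proof -
  obtain M where M: "\<And>x. (1 + x\<^sup>2) * cmod (f x) \<le> M"
    using assms by (auto simp: fast_decay_def)
  have B: "0 \<le> B" using assms(3) norm_ge_zero order_trans by blast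
  have "(1 + x\<^sup>2) * cmod (k x * f x) \<le> B * M" for x
  proof -
    have "(1 + x\<^sup>2) * cmod (k x * f x) = cmod (k x) * ((1 + x\<^sup>2) * cmod (f x))"
      by (simp add: norm_mult)
    also have "\<dots> \<le> B * M"
      by (intro mult_mono assms M B) simp
    finally show ?thesis .
  qed
  then show ?thesis
    using assms unfolding fast_decay_def by (auto intro!: continuous_intros)
qed

lemma fast_decay_cmult: "fast_decay f \<Longrightarrow> fast_decay (\<lambda>x. c * f x)"
  by (rule fast_decay_bounded_mult[where B = "cmod c"]) auto

lemma fast_decay_uminus: "fast_decay f \<Longrightarrow> fast_decay (\<lambda>x. - f x)"
  using fast_decay_cmult[of f "-1"] by simp

lemma fast_decay_diff: "fast_decay f \<Longrightarrow> fast_decay g \<Longrightarrow> fast_decay (\<lambda>x. f x - g x)"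
  using fast_decay_add[of f "\<lambda>x. - g x"] fast_decay_uminus[of g] by simp

lemmas fast_decay_intros =
  fast_decay_add fast_decay_diff fast_decay_cmult fast_decay_uminus schwartz_power_fast_decay schwartz_fast_decay

section \<open>Integrability and vanishing boundary terms\<close>

lemma integrable_inverse_1_plus_square': "integrable lborel (\<lambda>x::real. inverse (1 + x\<^sup>2))"
  using integrable_inverse_1_plus_square by (simp add: set_integrable_def einterval_eq)

lemma fast_decay_integrable:
  assumes "fast_decay f"
  shows "integrable lborel f"
proof -
  obtain M where M: "\<And>x. (1 + x\<^sup>2) * cmod (f x) \<le> M"
    using assms by (auto simp: fast_decay_def)
  have [measurable]: "f \<in> borel_measurable borel"
    using assms by (auto simp: fast_decay_def intro: borel_measurable_continuous_onI)
  have "cmod (f x) \<le> M * inverse (1 + x\<^sup>2)" for x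
  proof -
    have "1 + x\<^sup>2 > 0" by (simp add: add_pos_nonneg)
    then show ?thesis
      using M[of x] by (simp add: field_simps)
  qed
  then show ?thesis
    by (intro Bochner_Integration.integrable_bound[OF integrable_mult_right[OF integrable_inverse_1_plus_square', of M]])
       (auto intro!: AE_I2 intro: order_trans[OF _ abs_ge_self])
qed

lemma fast_decay_bounded:
  assumes "fast_decay f"
  obtains M where "\<And>x. cmod (f x) \<le> M"
proof -
  obtain M where M: "\<And>x. (1 + x\<^sup>2) * cmod (f x) \<le> M"
    using assms by (auto simp: fast_decay_def)
  have "cmod (f x) \<le> M" for x
    using M[of x] by (simp add: distrib_right) (smt (verit) mult_nonneg_nonneg norm_ge_zero zero_le_power2)
  then show thesis using that by blast
qed

lemma fast_decay_square_integrable: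
  assumes "fast_decay f"
  shows "integrable lborel (\<lambda>x. (cmod (f x))\<^sup>2)"
proof -
  obtain M where M: "\<And>x. cmod (f x) \<le> M"
    using fast_decay_bounded assms by blast
  have "fast_decay (\<lambda>x. cnj (f x) * f x)"
    using assms M by (intro fast_decay_bounded_mult[where B = M]) (auto simp: fast_decay_def intro: continuous_intros)
  from integrable_norm[OF fast_decay_integrable[OF this]] show ?thesis
    by (simp add: norm_mult power2_eq_square)
qed

lemma fast_decay_tendsto_0:
  assumes "fast_decay f"
  shows "(f \<longlongrightarrow> 0) at_top" "(f \<longlongrightarrow> 0) at_bot"
proof -
  obtain M where M: "\<And>x. (1 + x\<^sup>2) * cmod (f x) \<le> M"
    using assms by (auto simp: fast_decay_def)
  have le: "cmod (f x) \<le> M / (1 + x\<^sup>2)" for x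
  proof -
    have "1 + x\<^sup>2 > 0" by (simp add: add_pos_nonneg)
    then show ?thesis
      using M[of x] by (simp add: field_simps)
  qed
  have "((\<lambda>x::real. M / (1 + x\<^sup>2)) \<longlongrightarrow> 0) at_top" "((\<lambda>x::real. M / (1 + x\<^sup>2)) \<longlongrightarrow> 0) at_bot"
    by real_asymp+
  then show "(f \<longlongrightarrow> 0) at_top" "(f \<longlongrightarrow> 0) at_bot"
    by (auto intro: Lim_null_comparison[where g = "\<lambda>x. M / (1 + x\<^sup>2)"] simp: le)
qed

text \<open>The boundary values at both ends are zero. This takes the place of integration by parts:
  symmetry of the Hamiltonian is obtained by exhibiting an integrand as a total derivative.\<close>

lemma integral_derivative_fast_decay:
  assumes F: "\<And>x. (F has_vector_derivative f x) (at x)"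
    and "fast_decay F" "fast_decay f"
  shows "(LINT x|lborel. f x) = 0"
proof -
  have "(LBINT x=-\<infinity>..\<infinity>. f x) = 0 - 0"
  proof (rule interval_integral_FTC_integrable)
    show "(F has_vector_derivative f x) (at x)" for x by (rule F)
    show "isCont f x" for x
      using \<open>fast_decay f\<close> by (simp add: fast_decay_def continuous_on_eq_continuous_at)
    show "set_integrable lborel (einterval (-\<infinity>) \<infinity>) f"
      using fast_decay_integrable[OF \<open>fast_decay f\<close>] by (simp add: set_integrable_def einterval_eq)
    show "((F \<circ> real_of_ereal) \<longlongrightarrow> 0) (at_right (-\<infinity>))"
      using fast_decay_tendsto_0(2)[OF \<open>fast_decay F\<close>] by (simp add: ereal_tendsto_simps)
    show "((F \<circ> real_of_ereal) \<longlongrightarrow> 0) (at_left \<infinity>)"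
      using fast_decay_tendsto_0(1)[OF \<open>fast_decay F\<close>] by (simp add: ereal_tendsto_simps)
  qed simp
  then show ?thesis
    by (simp add: interval_lebesgue_integral_def set_lebesgue_integral_def einterval_eq)
qed

section \<open>Pairing with Gaussian solutions\<close>

text \<open>Converts the derivative into a quotient by a complex number, the form in which the
  evolution equation of the states is given.\<close>

lemma has_vector_derivative_quotient_tendsto:
  fixes f :: "real \<Rightarrow> complex"
  assumes "(f has_vector_derivative D) (at x)"
  shows "((\<lambda>h. (f (x + h) - f x) / complex_of_real h) \<longlongrightarrow> D) (at 0)"
proof -
  have "((\<lambda>h. norm (f (x + h) - f x - h *\<^sub>R D) / norm h) \<longlongrightarrow> 0) (at 0)"
    using assms by (simp add: has_vector_derivative_def has_derivative_at)
  then have "((\<lambda>h. norm ((f (x + h) - f x) / complex_of_real h - D)) \<longlongrightarrow> 0) (at 0)"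
  proof (rule Lim_transform_eventually)
    show "\<forall>\<^sub>F h in at 0. norm (f (x + h) - f x - h *\<^sub>R D) / norm h = norm ((f (x + h) - f x) / complex_of_real h - D)"
      unfolding eventually_at
    proof (intro exI[of _ 1] conjI ballI impI)
      fix h :: real assume "h \<noteq> 0 \<and> dist h 0 < 1"
      then have "(f (x + h) - f x) / complex_of_real h - D = (f (x + h) - f x - h *\<^sub>R D) / complex_of_real h"
        by (simp add: scaleR_conv_of_real field_simps)
      then show "norm (f (x + h) - f x - h *\<^sub>R D) / norm h = norm ((f (x + h) - f x) / complex_of_real h - D)"
        by (simp add: norm_divide)
    qed simp
  qed
  then show ?thesis
    by (rule LIM_zero_cancel[OF tendsto_norm_zero_cancel])
qed

text \<open>The version with a power of \<open>q\<close> is needed because increments of the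
  Gaussian in time are bounded only with the weight \<open>1 + q\<^sup>2\<close>, and that weight
  has to be absorbed by the other factor.\<close>

lemma ham_fast_decay:
  assumes "schwartz f"
  shows "fast_decay (ham \<kappa>' x f)" "fast_decay (\<lambda>q. complex_of_real q ^ m * ham \<kappa>' x f q)"
proof -
  have *: "complex_of_real q ^ m * ham \<kappa>' x f q =
     (-1/2) * (complex_of_real q ^ m * vd (vd f) q) + (\<kappa>' x / 2) * (complex_of_real q ^ (m+2) * f q)" for m q
    by (simp add: ham_def algebra_simps power_add power2_eq_square)
  show **: "fast_decay (\<lambda>q. complex_of_real q ^ m * ham \<kappa>' x f q)" for m
    unfolding * by (intro fast_decay_intros schwartz_vd assms)
  show "fast_decay (ham \<kappa>' x f)"
    using **[of 0] by simp
qed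

text \<open>The differential equations for the coefficients say exactly that \<open>gauss\<close> below solves
\<open>\<partial>\<^sub>x gauss = \<i> * ham gauss\<close>, the complex conjugate of the evolution equation.\<close>
locale riccati_gaussian =
  fixes I :: "real set" and \<kappa> :: "real \<Rightarrow> real" and \<alpha> \<beta> \<gamma> G :: "real \<Rightarrow> complex"
  assumes open_I: "open I"
    and \<kappa>_cont: "continuous_on I \<kappa>"
    and \<alpha>_deriv: "\<And>x. x \<in> I \<Longrightarrow>
      (\<alpha> has_vector_derivative (- 2 * \<i> * (\<alpha> x)\<^sup>2 + \<i> * \<kappa> x / 2)) (at x)"
    and \<beta>_deriv: "\<And>x. x \<in> I \<Longrightarrow> (\<beta> has_vector_derivative (- 2 * \<i> * \<alpha> x * \<beta> x)) (at x)"
    and \<gamma>_deriv: "\<And>x. x \<in> I \<Longrightarrow> (\<gamma> has_vector_derivative (- \<i> * (\<beta> x)\<^sup>2 / 2)) (at x)"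
    and G_deriv: "\<And>x. x \<in> I \<Longrightarrow> (G has_vector_derivative (- \<i> * \<alpha> x * G x)) (at x)"
    and Re_\<alpha>_neg: "\<And>x. x \<in> I \<Longrightarrow> Re (\<alpha> x) < 0"
begin

definition gauss :: "real \<Rightarrow> real \<Rightarrow> complex" where
  "gauss x q = G x * exp (\<alpha> x * (complex_of_real q)\<^sup>2 + \<beta> x * complex_of_real q + \<gamma> x)"

text \<open>The maximum of \<open>cmod (gauss x q)\<close> over \<open>q\<close>, read off by
  completing the square in the real part of the exponent.\<close>

definition peak :: "real \<Rightarrow> real" where
  "peak x = cmod (G x) * exp (Re (\<gamma> x) - (Re (\<beta> x))\<^sup>2 / (4 * Re (\<alpha> x)))"

text \<open>The polynomial by which \<open>\<i> * ham\<close> multiplies the Gaussian; the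
  subtracted bracket is what two derivatives in \<open>q\<close> bring down.\<close>

definition gauss_rate :: "real \<Rightarrow> real \<Rightarrow> complex" where
  "gauss_rate x q = (\<i> / 2) * (\<kappa> x * (complex_of_real q)\<^sup>2
     - ((2 * \<alpha> x * complex_of_real q + \<beta> x)\<^sup>2 + 2 * \<alpha> x))"

section \<open>Size and derivatives of the Gaussian\<close>

lemma coeffs_continuous:
  "continuous_on I \<alpha>" "continuous_on I \<beta>" "continuous_on I \<gamma>" "continuous_on I G"
  using \<alpha>_deriv \<beta>_deriv \<gamma>_deriv G_deriv
  by (meson continuous_at_imp_continuous_on has_vector_derivative_continuous)+

lemma cmod_gauss:
  assumes "x \<in> I"
  shows "cmod (gauss x q) = peak x * exp (Re (\<alpha> x) * (q + Re (\<beta> x) / (2 * Re (\<alpha> x)))\<^sup>2)"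
proof -
  have "Re (\<alpha> x) * q\<^sup>2 + Re (\<beta> x) * q + Re (\<gamma> x) =
      Re (\<gamma> x) - (Re (\<beta> x))\<^sup>2 / (4 * Re (\<alpha> x)) + Re (\<alpha> x) * (q + Re (\<beta> x) / (2 * Re (\<alpha> x)))\<^sup>2"
    using Re_\<alpha>_neg[OF assms] by (simp add: field_simps power2_eq_square)
  then show ?thesis
    by (simp add: gauss_def peak_def norm_mult flip: exp_add of_real_power)
qed

lemma cmod_gauss_le: "x \<in> I \<Longrightarrow> cmod (gauss x q) \<le> peak x"
  using Re_\<alpha>_neg[of x]
  by (auto simp: cmod_gauss peak_def mult_nonpos_nonneg intro!: mult_left_le)

text \<open>Written with a normal density so that integrability and the \<open>L2norm\<close> come
  from the density having total mass 1. The deviation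
  \<open>1 / (2 * sqrt (- Re (\<alpha> x)))\<close> accounts for the doubling of the exponent by the
  square.\<close>

lemma gauss_square:
  assumes "x \<in> I"
  shows "(cmod (gauss x q))\<^sup>2 = (peak x)\<^sup>2 * sqrt (pi / (- 2 * Re (\<alpha> x))) *
    normal_density (- Re (\<beta> x) / (2 * Re (\<alpha> x))) (1 / (2 * sqrt (- Re (\<alpha> x)))) q"
proof -
  have "(exp (Re (\<alpha> x) * (q + Re (\<beta> x) / (2 * Re (\<alpha> x)))\<^sup>2))\<^sup>2
     = exp (2 * Re (\<alpha> x) * (q + Re (\<beta> x) / (2 * Re (\<alpha> x)))\<^sup>2)"
    by (simp add: mult_ac flip: exp_double)
  moreover have "sqrt (pi / (- 2 * Re (\<alpha> x))) \<noteq> 0"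
    using Re_\<alpha>_neg[OF assms] by simp
  moreover have "2 * pi * (1 / (2 * sqrt (- Re (\<alpha> x))))\<^sup>2 = pi / (- 2 * Re (\<alpha> x))"
    using Re_\<alpha>_neg[OF assms] by (simp add: power_divide power_mult_distrib)
  moreover have "- (q + Re (\<beta> x) / (2 * Re (\<alpha> x)))\<^sup>2 / (2 * (1 / (2 * sqrt (- Re (\<alpha> x))))\<^sup>2)
      = 2 * Re (\<alpha> x) * (q + Re (\<beta> x) / (2 * Re (\<alpha> x)))\<^sup>2"
    using Re_\<alpha>_neg[OF assms] by (simp add: power_divide power_mult_distrib)
  ultimately show ?thesis
    by (simp add: cmod_gauss[OF assms] power_mult_distrib normal_density_def)
qed

lemma gauss_q_deriv:
  "(gauss x has_vector_derivative (2 * \<alpha> x * complex_of_real q + \<beta> x) * gauss x q) (at q)"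
  unfolding gauss_def
  by (rule has_vector_derivative_real_field) (auto intro!: derivative_eq_intros simp: algebra_simps)

lemma gauss_qq_deriv:
  "((\<lambda>q. (2 * \<alpha> x * complex_of_real q + \<beta> x) * gauss x q) has_vector_derivative
     ((2 * \<alpha> x * complex_of_real q + \<beta> x)\<^sup>2 + 2 * \<alpha> x) * gauss x q) (at q)"
  unfolding gauss_def
  by (rule has_vector_derivative_real_field)
     (auto intro!: derivative_eq_intros simp: algebra_simps power2_eq_square)

text \<open>Comparing the coefficients of \<open>q\<^sup>2\<close>, \<open>q\<close> and 1 gives
  exactly the equations for \<alpha>, \<beta> and \<gamma>; the leftover constant
  \<open>- \<i> * \<alpha> x\<close> is supplied by the prefactor \<open>G\<close>.\<close>

lemma gauss_x_deriv:
  assumes "x \<in> I"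
  shows "((\<lambda>x. gauss x q) has_vector_derivative gauss_rate x q * gauss x q) (at x)"
proof -
  let ?E = "\<lambda>x. \<alpha> x * (complex_of_real q)\<^sup>2 + \<beta> x * complex_of_real q + \<gamma> x"
  let ?E' = "(- 2 * \<i> * (\<alpha> x)\<^sup>2 + \<i> * \<kappa> x / 2) * (complex_of_real q)\<^sup>2
     + (- 2 * \<i> * \<alpha> x * \<beta> x) * complex_of_real q + (- \<i> * (\<beta> x)\<^sup>2 / 2)"
  have E: "(?E has_vector_derivative ?E') (at x)"
    by (intro has_vector_derivative_add has_vector_derivative_mult_left \<alpha>_deriv \<beta>_deriv \<gamma>_deriv assms)
  have "((exp \<circ> ?E) has_vector_derivative ?E' * exp (?E x)) (at x)"
    by (rule field_vector_diff_chain_at[OF E DERIV_exp])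
  from has_vector_derivative_mult[OF G_deriv[OF assms] this]
  have "((\<lambda>x. gauss x q) has_vector_derivative
      G x * (?E' * exp (?E x)) + - \<i> * \<alpha> x * G x * exp (?E x)) (at x)"
    by (simp add: gauss_def[abs_def])
  moreover have "G x * (?E' * exp (?E x)) + - \<i> * \<alpha> x * G x * exp (?E x)
      = (?E' - \<i> * \<alpha> x) * gauss x q"
    by (simp add: gauss_def algebra_simps)
  moreover have "?E' - \<i> * \<alpha> x = gauss_rate x q"
    unfolding gauss_rate_def by (simp add: field_simps power2_eq_square)
  ultimately show ?thesis by simp
qed

lemma gauss_rate_le:
  "cmod (gauss_rate x q) \<le>
    (cmod (\<kappa> x / 2 - 2 * (\<alpha> x)\<^sup>2) + cmod (2 * \<alpha> x * \<beta> x) + cmod ((\<beta> x)\<^sup>2 / 2 + \<alpha> x)) * (1 + q\<^sup>2)"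
proof -
  have "gauss_rate x q = \<i> * ((\<kappa> x / 2 - 2 * (\<alpha> x)\<^sup>2) * (complex_of_real q)\<^sup>2
      - (2 * \<alpha> x * \<beta> x) * complex_of_real q - ((\<beta> x)\<^sup>2 / 2 + \<alpha> x))"
    unfolding gauss_rate_def by (simp add: field_simps power2_eq_square)
  then have "cmod (gauss_rate x q) = cmod ((\<kappa> x / 2 - 2 * (\<alpha> x)\<^sup>2) * (complex_of_real q)\<^sup>2
      - (2 * \<alpha> x * \<beta> x) * complex_of_real q - ((\<beta> x)\<^sup>2 / 2 + \<alpha> x))"
    by (simp only: norm_mult norm_ii mult_1)
  also have "\<dots> \<le> cmod ((\<kappa> x / 2 - 2 * (\<alpha> x)\<^sup>2) * (complex_of_real q)\<^sup>2)
      + cmod ((2 * \<alpha> x * \<beta> x) * complex_of_real q) + cmod ((\<beta> x)\<^sup>2 / 2 + \<alpha> x)"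
    by (meson add_mono norm_triangle_ineq4 order_refl order_trans)
  also have "\<dots> = cmod (\<kappa> x / 2 - 2 * (\<alpha> x)\<^sup>2) * q\<^sup>2 + cmod (2 * \<alpha> x * \<beta> x) * \<bar>q\<bar>
      + cmod ((\<beta> x)\<^sup>2 / 2 + \<alpha> x) * 1"
    by (simp add: norm_mult norm_power)
  also have "\<dots> \<le> cmod (\<kappa> x / 2 - 2 * (\<alpha> x)\<^sup>2) * (1 + q\<^sup>2) + cmod (2 * \<alpha> x * \<beta> x) * (1 + q\<^sup>2)
      + cmod ((\<beta> x)\<^sup>2 / 2 + \<alpha> x) * (1 + q\<^sup>2)"
  proof -
    have "0 \<le> (\<bar>q\<bar> - 1)\<^sup>2" by simp
    then have "2 * \<bar>q\<bar> \<le> 1 + q\<^sup>2" by (simp add: power2_diff)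
    then have "\<bar>q\<bar> \<le> 1 + q\<^sup>2" by simp
    then show ?thesis
      by (intro add_mono mult_left_mono) auto
  qed
  finally show ?thesis by (simp add: distrib_right)
qed

lemma continuous_on_gauss: "continuous_on UNIV (gauss x)"
  using gauss_q_deriv
  by (meson continuous_at_imp_continuous_on has_vector_derivative_continuous)

text \<open>All bounds are controlled by continuous functions of the coefficients, which are bounded
  on a compact ball. One constant valid for all nearby times is what domination needs when the
  pairing is differentiated in time.\<close>

lemma gauss_local_bounds:
  assumes "x \<in> I"
  obtains d K where "d > 0" "cball x d \<subseteq> I"
    "\<And>y q. y \<in> cball x d \<Longrightarrow> cmod (gauss y q) \<le> K"
    "\<And>y q. y \<in> cball x d \<Longrightarrow> cmod (gauss_rate y q * gauss y q) \<le> K * (1 + q\<^sup>2)"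
    "\<And>y. y \<in> cball x d \<Longrightarrow> integrable lborel (\<lambda>q. (cmod (gauss y q))\<^sup>2)"
    "\<And>y. y \<in> cball x d \<Longrightarrow> (LINT q|lborel. (cmod (gauss y q))\<^sup>2) \<le> K"
proof -
  obtain d where d: "d > 0" "cball x d \<subseteq> I"
    using open_I assms open_contains_cball by blast
  have cont: "continuous_on (cball x d) \<alpha>" "continuous_on (cball x d) \<beta>"
      "continuous_on (cball x d) \<gamma>" "continuous_on (cball x d) G" "continuous_on (cball x d) \<kappa>"
    using coeffs_continuous \<kappa>_cont d(2) continuous_on_subset by blast+
  have nz: "Re (\<alpha> y) < 0" if "y \<in> cball x d" for y
    using Re_\<alpha>_neg d(2) that by blast
  then have nz': "Re (\<alpha> y) \<noteq> 0" if "y \<in> cball x d" for y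
    using that by fastforce
  let ?R = "\<lambda>x. cmod (\<kappa> x / 2 - 2 * (\<alpha> x)\<^sup>2) + cmod (2 * \<alpha> x * \<beta> x) + cmod ((\<beta> x)\<^sup>2 / 2 + \<alpha> x)"
  let ?A = "\<lambda>x. (peak x)\<^sup>2 * sqrt (pi / (- 2 * Re (\<alpha> x)))"
  have cp: "continuous_on (cball x d) peak"
    unfolding peak_def using nz' by (intro continuous_intros cont) auto
  have cR: "continuous_on (cball x d) (\<lambda>x. ?R x * peak x)"
    by (intro continuous_intros cont cp) auto
  have cA: "continuous_on (cball x d) ?A"
    using nz' by (intro continuous_intros cont cp) auto
  have bd: "\<exists>K. \<forall>y\<in>cball x d. f y \<le> K" if "continuous_on (cball x d) f" for f :: "real \<Rightarrow> real"
    using compact_continuous_image[OF that compact_cball] compact_imp_bounded bounded_iff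
    by (metis abs_le_D1 image_eqI real_norm_def)
  obtain K1 K2 K3 where K: "\<And>y. y \<in> cball x d \<Longrightarrow> peak y \<le> K1"
      "\<And>y. y \<in> cball x d \<Longrightarrow> ?R y * peak y \<le> K2" "\<And>y. y \<in> cball x d \<Longrightarrow> ?A y \<le> K3"
    using bd[OF cp] bd[OF cR] bd[OF cA] by blast
  define K where "K = max K1 (max K2 K3)"
  show thesis
  proof (rule that[OF d, of K])
    fix y assume y: "y \<in> cball x d"
    then have yI: "y \<in> I" using d(2) by blast
    show "cmod (gauss y q) \<le> K" for q
      using cmod_gauss_le[OF yI, of q] K(1)[OF y] by (simp add: K_def)
    show "cmod (gauss_rate y q * gauss y q) \<le> K * (1 + q\<^sup>2)" for q
    proof -
      have "cmod (gauss_rate y q * gauss y q) \<le> (?R y * (1 + q\<^sup>2)) * peak y"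
        unfolding norm_mult[of "gauss_rate y q"] by (intro mult_mono gauss_rate_le cmod_gauss_le yI) auto
      also have "\<dots> = (?R y * peak y) * (1 + q\<^sup>2)" by simp
      also have "\<dots> \<le> K * (1 + q\<^sup>2)"
        using K(2)[OF y] by (intro mult_right_mono) (auto simp: K_def)
      finally show ?thesis .
    qed
    have "- Re (\<alpha> y) > 0" using nz[OF y] by simp
    then have s: "1 / (2 * sqrt (- Re (\<alpha> y))) > 0" by simp
    show "integrable lborel (\<lambda>q. (cmod (gauss y q))\<^sup>2)"
      unfolding gauss_square[OF yI] using s by (intro integrable_mult_right integrable_normal_density)
    show "(LINT q|lborel. (cmod (gauss y q))\<^sup>2) \<le> K"
      unfolding gauss_square[OF yI] using s K(3)[OF y]
      by (simp add: K_def)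
  qed
qed

lemma gauss_poly_fast_decay:
  assumes "x \<in> I" "schwartz f"
  shows "fast_decay (\<lambda>q. complex_of_real q ^ m * (gauss x q * f q))"
proof -
  have "fast_decay (\<lambda>q. gauss x q * (complex_of_real q ^ m * f q))"
    using fast_decay_bounded_mult[OF schwartz_power_fast_decay[OF assms(2)] continuous_on_gauss cmod_gauss_le[OF assms(1)]] .
  then show ?thesis by (simp add: mult_ac)
qed

text \<open>The integrand is the \<open>q\<close>-derivative of \<open>\<i>/2 * (gauss * f' - gauss' * f)\<close>.\<close>
lemma gauss_ham_symmetric:
  assumes "x \<in> I" "schwartz f"
  shows "(LINT q|lborel. gauss_rate x q * gauss x q * f q + gauss x q * (- \<i> * ham \<kappa> x f q)) = 0"
proof -
  let ?L = "\<lambda>q. 2 * \<alpha> x * complex_of_real q + \<beta> x"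
  define F where "F q = (\<i> / 2) * (gauss x q * vd f q - ?L q * gauss x q * f q)" for q
  define F' where "F' q = (\<i> / 2) * (gauss x q * vd (vd f) q - (?L q ^ 2 + 2 * \<alpha> x) * gauss x q * f q)" for q
  have d1: "(f has_vector_derivative vd f q) (at q)" "(vd f has_vector_derivative vd (vd f) q) (at q)" for q
    using schwartz_has_vector_derivative schwartz_vd assms(2) by blast+
  have deriv: "(F has_vector_derivative F' q) (at q)" for q
  proof -
    have "(F has_vector_derivative (\<i> / 2) * ((gauss x q * vd (vd f) q + (?L q * gauss x q) * vd f q)
        - ((?L q * gauss x q) * vd f q + ((?L q)\<^sup>2 + 2 * \<alpha> x) * gauss x q * f q))) (at q)"
      unfolding F_def[abs_def]
      by (intro has_vector_derivative_mult_right has_vector_derivative_diff has_vector_derivative_mult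
          gauss_q_deriv gauss_qq_deriv d1)
    then show ?thesis by (simp add: F'_def)
  qed
  have F_eq: "F = (\<lambda>q. (\<i> / 2) * (complex_of_real q ^ 0 * (gauss x q * vd f q))
      + (- \<i> * \<alpha> x) * (complex_of_real q ^ 1 * (gauss x q * f q))
      + (- \<i> * \<beta> x / 2) * (complex_of_real q ^ 0 * (gauss x q * f q)))"
    by (simp add: F_def[abs_def] algebra_simps)
  have "fast_decay F"
    unfolding F_eq by (intro fast_decay_add fast_decay_cmult gauss_poly_fast_decay assms schwartz_vd)
  have F'_eq: "F' = (\<lambda>q. (\<i> / 2) * (complex_of_real q ^ 0 * (gauss x q * vd (vd f) q))
      + (- 2 * \<i> * (\<alpha> x)\<^sup>2) * (complex_of_real q ^ 2 * (gauss x q * f q))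
      + (- 2 * \<i> * \<alpha> x * \<beta> x) * (complex_of_real q ^ 1 * (gauss x q * f q))
      + (- \<i> * ((\<beta> x)\<^sup>2 / 2 + \<alpha> x)) * (complex_of_real q ^ 0 * (gauss x q * f q)))"
    by (simp add: F'_def[abs_def] algebra_simps power2_eq_square fun_eq_iff)
  have "fast_decay F'"
    unfolding F'_eq by (intro fast_decay_add fast_decay_cmult gauss_poly_fast_decay assms schwartz_vd)
  have "gauss_rate x q * gauss x q * f q + gauss x q * (- \<i> * ham \<kappa> x f q) = F' q" for q
    unfolding gauss_rate_def ham_def F'_def by (simp add: algebra_simps)
  then show ?thesis
    using integral_derivative_fast_decay[OF deriv \<open>fast_decay F\<close> \<open>fast_decay F'\<close>] by simp
qed

text \<open>With \<open>\<rho> h\<close> for the error in the evolution equation and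
  \<open>g = - \<i> * ham\<close>, the difference quotient of the pairing splits into three
  integrals: the increment of the Gaussian against the fixed state, the moved Gaussian against
  \<open>g\<close>, and the moved Gaussian against \<open>\<rho> h\<close>. The limits of the first
  two cancel by symmetry of the Hamiltonian. The third vanishes because the Gaussians stay bounded
  in \<open>L2norm\<close>; smallness of \<open>\<rho> h\<close> is available in that norm
  only.\<close>

lemma pairing_has_derivative_0:
  assumes x: "x \<in> I"
    and S: "\<And>y. y \<in> I \<Longrightarrow> schwartz (u y)"
    and L2: "((\<lambda>h. L2norm (\<lambda>q. (u (x + h) q - u x q) / complex_of_real h + \<i> * ham \<kappa> x (u x) q)) \<longlongrightarrow> 0) (at 0)"
  shows "((\<lambda>y. LINT q|lborel. gauss y q * u y q) has_vector_derivative 0) (at x)"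
proof -
  obtain d K where d: "d > 0" "cball x d \<subseteq> I"
    and K1: "\<And>y q. y \<in> cball x d \<Longrightarrow> cmod (gauss y q) \<le> K"
    and K2: "\<And>y q. y \<in> cball x d \<Longrightarrow> cmod (gauss_rate y q * gauss y q) \<le> K * (1 + q\<^sup>2)"
    and K3: "\<And>y. y \<in> cball x d \<Longrightarrow> integrable lborel (\<lambda>q. (cmod (gauss y q))\<^sup>2)"
    and K4: "\<And>y. y \<in> cball x d \<Longrightarrow> (LINT q|lborel. (cmod (gauss y q))\<^sup>2) \<le> K"
    using gauss_local_bounds[OF x] by metis
  define f where "f = u x"
  have Sf: "schwartz f" using S[OF x] by (simp add: f_def)
  have [simp]: "x \<in> cball x d" using d by simp
  have K0: "0 \<le> K" using K1[OF \<open>x \<in> cball x d\<close>, of 0] norm_ge_zero[of "gauss x 0"] by linarith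
  \<comment> \<open>The mean value inequality in time; the factor \<open>1 + q\<^sup>2\<close> is
    the price of a constant that is uniform in \<open>q\<close>.\<close>
  have inc: "cmod (gauss (x + h) q - gauss x q) \<le> K * (1 + q\<^sup>2) * \<bar>h\<bar>" if "\<bar>h\<bar> < d" for h q
  proof -
    have "norm (gauss (x + h) q - gauss x q) \<le> K * (1 + q\<^sup>2) * norm ((x + h) - x)"
    proof (rule differentiable_bound[where S = "cball x d"])
      show "((\<lambda>y. gauss y q) has_derivative (\<lambda>h. h *\<^sub>R (gauss_rate y q * gauss y q))) (at y within cball x d)"
        if "y \<in> cball x d" for y
        using gauss_x_deriv[of y q] that d(2) has_derivative_at_withinI
        unfolding has_vector_derivative_def by blast
      show "onorm (\<lambda>h. h *\<^sub>R (gauss_rate y q * gauss y q)) \<le> K * (1 + q\<^sup>2)"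
        if "y \<in> cball x d" for y
      proof (rule onorm_bound)
        show "0 \<le> K * (1 + q\<^sup>2)" using K0 by simp
        show "norm (h *\<^sub>R (gauss_rate y q * gauss y q)) \<le> K * (1 + q\<^sup>2) * norm h" for h
          using mult_left_mono[OF K2[OF that, of q] abs_ge_zero[of h]]
          by (simp only: norm_scaleR real_norm_def mult.commute)
      qed
    qed (use that d in \<open>auto simp: dist_real_def\<close>)
    then show ?thesis by simp
  qed
  define \<rho> where "\<rho> h q = (u (x + h) q - u x q) / complex_of_real h + \<i> * ham \<kappa> x (u x) q" for h q
  have in_ball: "x + h \<in> cball x d" if "\<bar>h\<bar> < d" for h
    using that by (simp add: dist_real_def)
  have in_I: "x + h \<in> I" if "\<bar>h\<bar> < d" for h
    using in_ball[OF that] d by blast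
  have \<rho>_decay: "fast_decay (\<rho> h)" if "\<bar>h\<bar> < d" for h
  proof -
    have "\<rho> h = (\<lambda>q. (1 / complex_of_real h) * (u (x + h) q - u x q) + \<i> * ham \<kappa> x (u x) q)"
      by (simp add: \<rho>_def fun_eq_iff)
    then show ?thesis
      by (simp only:) (intro fast_decay_intros ham_fast_decay S in_I that x)
  qed
  have mult_decay: "fast_decay (\<lambda>q. gauss (x + h) q * g q)" if "fast_decay g" "\<bar>h\<bar> < d" for g h
    using fast_decay_bounded_mult[OF that(1) continuous_on_gauss K1[OF in_ball[OF that(2)]]] .
  have mult_decay0: "fast_decay (\<lambda>q. gauss x q * g q)" if "fast_decay g" for g
    using mult_decay[of g 0] that d by simp
  have near: "\<forall>\<^sub>F h in at 0. \<bar>h\<bar> < d \<and> h \<noteq> 0"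
    using d(1) by (auto simp: eventually_at dist_real_def)

  have weighted: "integrable lborel (\<lambda>q. K * (1 + q\<^sup>2) * cmod (g q))"
    if "fast_decay g" "fast_decay (\<lambda>q. complex_of_real q ^ 2 * g q)" for g
  proof -
    have "integrable lborel (\<lambda>q. K * (cmod (g q) + cmod (complex_of_real q ^ 2 * g q)))"
      using that fast_decay_integrable by (intro integrable_mult_right Bochner_Integration.integrable_add integrable_norm) auto
    then show ?thesis
      by (simp add: norm_mult norm_power algebra_simps)
  qed

  have lim1: "((\<lambda>h. LINT q|lborel. (gauss (x + h) q - gauss x q) / h * f q)
      \<longlongrightarrow> (LINT q|lborel. gauss_rate x q * gauss x q * f q)) (at 0)"
  proof -
    have "((\<lambda>h. LINT q|lborel. (gauss (x + h) q - gauss x q) / h * f q)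
      \<longlongrightarrow> (LINT q|lborel. gauss_rate x q * gauss x q * f q)) (at 0 within ball 0 d)"
      \<comment> \<open>Dominated convergence is applied along sequences; confining them to
        \<open>ball 0 d\<close> makes the majorant valid for every term.\<close>
      unfolding tendsto_at_iff_sequentially comp_def
    proof (intro allI impI)
      fix X :: "nat \<Rightarrow> real"
      assume X: "\<forall>i. X i \<in> ball 0 d - {0}" "X \<longlonglongrightarrow> 0"
      then have Xd: "\<bar>X i\<bar> < d" "X i \<noteq> 0" for i by (auto simp: dist_real_def)
      have [measurable]: "f \<in> borel_measurable borel"
        using schwartz_continuous[OF Sf] by (rule borel_measurable_continuous_onI)
      have [measurable]: "gauss y \<in> borel_measurable borel" for y
        using continuous_on_gauss by (rule borel_measurable_continuous_onI)
      have [measurable]: "gauss_rate y \<in> borel_measurable borel" for y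
        unfolding gauss_rate_def[abs_def]
        by (intro borel_measurable_continuous_onI continuous_intros)
      show "(\<lambda>i. LINT q|lborel. (gauss (x + X i) q - gauss x q) / X i * f q)
        \<longlonglongrightarrow> (LINT q|lborel. gauss_rate x q * gauss x q * f q)"
      proof (rule integral_dominated_convergence[where w = "\<lambda>q. K * (1 + q\<^sup>2) * cmod (f q)"])
        show "integrable lborel (\<lambda>q. K * (1 + q\<^sup>2) * cmod (f q))"
          by (intro weighted schwartz_power_fast_decay schwartz_fast_decay Sf)
        show "AE q in lborel. (\<lambda>i. (gauss (x + X i) q - gauss x q) / X i * f q)
            \<longlonglongrightarrow> gauss_rate x q * gauss x q * f q"
        proof (intro AE_I2 tendsto_intros)
          fix q
          have "((\<lambda>h. (gauss (x + h) q - gauss x q) / complex_of_real h) \<longlongrightarrow> gauss_rate x q * gauss x q) (at 0)"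
            by (rule has_vector_derivative_quotient_tendsto[OF gauss_x_deriv[OF x]])
          then show "(\<lambda>i. (gauss (x + X i) q - gauss x q) / complex_of_real (X i)) \<longlonglongrightarrow> gauss_rate x q * gauss x q"
            by (rule filterlim_compose) (use X Xd in \<open>auto simp: filterlim_at\<close>)
        qed
        show "AE q in lborel. cmod ((gauss (x + X i) q - gauss x q) / X i * f q) \<le> K * (1 + q\<^sup>2) * cmod (f q)" for i
        proof (intro AE_I2)
          fix q
          have "cmod (gauss (x + X i) q - gauss x q) / \<bar>X i\<bar> \<le> K * (1 + q\<^sup>2)"
            using inc[OF Xd(1)[of i], of q] Xd(2)[of i] by (simp add: pos_divide_le_eq)
          then show "cmod ((gauss (x + X i) q - gauss x q) / X i * f q) \<le> K * (1 + q\<^sup>2) * cmod (f q)"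
            unfolding norm_mult norm_divide by (intro mult_right_mono) auto
        qed
      qed measurable
    qed
    then show ?thesis
      using d(1) at_within_open[of "0::real" "ball 0 d"] by simp
  qed

  define g where "g q = - \<i> * ham \<kappa> x f q" for q
  have g_decay: "fast_decay g" "fast_decay (\<lambda>q. complex_of_real q ^ 2 * g q)"
  proof -
    show "fast_decay g" unfolding g_def[abs_def] by (intro fast_decay_cmult ham_fast_decay Sf)
    have "fast_decay (\<lambda>q. - \<i> * (complex_of_real q ^ 2 * ham \<kappa> x f q))"
      by (intro fast_decay_cmult ham_fast_decay Sf)
    then show "fast_decay (\<lambda>q. complex_of_real q ^ 2 * g q)"
      by (simp only: mult.left_commute g_def)
  qed
  \<comment> \<open>No limit theorem is needed here: \<open>inc\<close> bounds the difference by
    \<open>\<bar>h\<bar>\<close> times a fixed integral, finite since \<open>g\<close> remains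
    integrable under the weight.\<close>
  have lim2: "((\<lambda>h. LINT q|lborel. gauss (x + h) q * g q) \<longlongrightarrow> (LINT q|lborel. gauss x q * g q)) (at 0)"
  proof (rule LIM_zero_cancel, rule Lim_null_comparison)
    let ?C = "LINT q|lborel. K * (1 + q\<^sup>2) * cmod (g q)"
    show "((\<lambda>h. \<bar>h\<bar> * ?C) \<longlongrightarrow> 0) (at 0)"
      by (auto intro!: tendsto_eq_intros)
    show "\<forall>\<^sub>F h in at 0. norm ((LINT q|lborel. gauss (x + h) q * g q) - (LINT q|lborel. gauss x q * g q)) \<le> \<bar>h\<bar> * ?C"
      using near
    proof eventually_elim
      case (elim h)
      have i: "integrable lborel (\<lambda>q. gauss (x + h) q * g q)" "integrable lborel (\<lambda>q. gauss x q * g q)"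
        using elim by (auto intro!: fast_decay_integrable mult_decay mult_decay0 g_decay)
      have "norm ((LINT q|lborel. gauss (x + h) q * g q) - (LINT q|lborel. gauss x q * g q))
         = norm (LINT q|lborel. gauss (x + h) q * g q - gauss x q * g q)"
        by (subst Bochner_Integration.integral_diff[OF i]) simp
      also have "\<dots> \<le> (LINT q|lborel. \<bar>h\<bar> * (K * (1 + q\<^sup>2) * cmod (g q)))"
      proof (rule Bochner_Integration.integral_norm_bound_integral)
        show "integrable lborel (\<lambda>q. gauss (x + h) q * g q - gauss x q * g q)"
          by (intro Bochner_Integration.integrable_diff i)
        show "integrable lborel (\<lambda>q. \<bar>h\<bar> * (K * (1 + q\<^sup>2) * cmod (g q)))"
          by (intro integrable_mult_right weighted g_decay)
        fix q
        have "norm (gauss (x + h) q * g q - gauss x q * g q) = cmod (gauss (x + h) q - gauss x q) * cmod (g q)"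
          by (simp only: norm_mult[symmetric] left_diff_distrib)
        also have "\<dots> \<le> (K * (1 + q\<^sup>2) * \<bar>h\<bar>) * cmod (g q)"
          using elim by (intro mult_right_mono inc) auto
        finally show "norm (gauss (x + h) q * g q - gauss x q * g q) \<le> \<bar>h\<bar> * (K * (1 + q\<^sup>2) * cmod (g q))"
          by (simp only: mult_ac)
      qed
      also have "\<dots> = \<bar>h\<bar> * ?C" by simp
      finally show ?case .
    qed
  qed

  \<comment> \<open>Young's inequality with weight \<open>L2norm (\<rho> h) + \<bar>h\<bar>\<close>, which stays positive even if the remainder vanishes.\<close>
  have lim3: "((\<lambda>h. LINT q|lborel. gauss (x + h) q * \<rho> h q) \<longlongrightarrow> 0) (at 0)"
  proof (rule Lim_null_comparison)
    let ?L = "\<lambda>h. L2norm (\<rho> h)"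
    have L: "(?L \<longlongrightarrow> 0) (at 0)" using L2 by (simp add: \<rho>_def[abs_def])
    show "((\<lambda>h. ((?L h + \<bar>h\<bar>) * K + ?L h) / 2) \<longlongrightarrow> 0) (at 0)"
      by (rule tendsto_eq_intros L refl | simp)+
    show "\<forall>\<^sub>F h in at 0. norm (LINT q|lborel. gauss (x + h) q * \<rho> h q) \<le> ((?L h + \<bar>h\<bar>) * K + ?L h) / 2"
      using near
    proof eventually_elim
      case (elim h)
      define \<eta> where "\<eta> = ?L h + \<bar>h\<bar>"
      have L0: "?L h \<ge> 0" by (simp add: L2norm_def)
      then have \<eta>: "\<eta> > 0" using elim by (simp add: \<eta>_def add_nonneg_pos)
      have Lsq: "(LINT q|lborel. (cmod (\<rho> h q))\<^sup>2) = (?L h)\<^sup>2"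
        by (simp add: L2norm_def)
      have i: "integrable lborel (\<lambda>q. gauss (x + h) q * \<rho> h q)"
        using elim by (intro fast_decay_integrable mult_decay \<rho>_decay) auto
      have i1: "integrable lborel (\<lambda>q. (cmod (gauss (x + h) q))\<^sup>2)"
        using K3 in_ball elim by blast
      have i2: "integrable lborel (\<lambda>q. (cmod (\<rho> h q))\<^sup>2)"
        using \<rho>_decay elim fast_decay_square_integrable by blast
      have "norm (LINT q|lborel. gauss (x + h) q * \<rho> h q)
         \<le> (LINT q|lborel. (\<eta> / 2) * (cmod (gauss (x + h) q))\<^sup>2 + (1 / (2 * \<eta>)) * (cmod (\<rho> h q))\<^sup>2)"
      proof (rule Bochner_Integration.integral_norm_bound_integral[OF i])
        show "integrable lborel (\<lambda>q. (\<eta> / 2) * (cmod (gauss (x + h) q))\<^sup>2 + (1 / (2 * \<eta>)) * (cmod (\<rho> h q))\<^sup>2)"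
          by (intro Bochner_Integration.integrable_add integrable_mult_right i1 i2)
        fix q
        have "0 \<le> (\<eta> * cmod (gauss (x + h) q) - cmod (\<rho> h q))\<^sup>2" by simp
        then have "2 * \<eta> * (cmod (gauss (x + h) q) * cmod (\<rho> h q)) \<le> \<eta>\<^sup>2 * (cmod (gauss (x + h) q))\<^sup>2 + (cmod (\<rho> h q))\<^sup>2"
          by (simp add: power2_diff power_mult_distrib mult_ac)
        then show "norm (gauss (x + h) q * \<rho> h q)
           \<le> (\<eta> / 2) * (cmod (gauss (x + h) q))\<^sup>2 + (1 / (2 * \<eta>)) * (cmod (\<rho> h q))\<^sup>2"
          using \<eta> by (simp add: norm_mult field_simps power2_eq_square)
      qed
      also have "\<dots> = (\<eta> / 2) * (LINT q|lborel. (cmod (gauss (x + h) q))\<^sup>2) + (1 / (2 * \<eta>)) * (?L h)\<^sup>2"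
        unfolding Lsq[symmetric]
        by (subst Bochner_Integration.integral_add) (auto intro!: integrable_mult_right i1 i2)
      also have "\<dots> \<le> (\<eta> / 2) * K + ?L h / 2"
      proof (rule add_mono)
        show "(\<eta> / 2) * (LINT q|lborel. (cmod (gauss (x + h) q))\<^sup>2) \<le> (\<eta> / 2) * K"
          using \<eta> K4 in_ball elim by (intro mult_left_mono) auto
        have "(?L h)\<^sup>2 \<le> ?L h * \<eta>"
          unfolding power2_eq_square using L0 by (intro mult_left_mono) (auto simp: \<eta>_def)
        then show "(1 / (2 * \<eta>)) * (?L h)\<^sup>2 \<le> ?L h / 2"
          using \<eta> by (simp add: field_simps)
      qed
      also have "\<dots> = ((?L h + \<bar>h\<bar>) * K + ?L h) / 2"
        by (simp add: \<eta>_def add_divide_distrib)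
      finally show ?case .
    qed
  qed

  let ?J = "\<lambda>y. LINT q|lborel. gauss y q * u y q"
  have "((\<lambda>h. (LINT q|lborel. (gauss (x + h) q - gauss x q) / h * f q)
       + (LINT q|lborel. gauss (x + h) q * g q) + (LINT q|lborel. gauss (x + h) q * \<rho> h q))
      \<longlongrightarrow> (LINT q|lborel. gauss_rate x q * gauss x q * f q) + (LINT q|lborel. gauss x q * g q) + 0) (at 0)"
    by (intro tendsto_add lim1 lim2 lim3)
  \<comment> \<open>Each integrand must be integrable separately before the two limits can be joined
    into the single integral that vanishes by symmetry.\<close>
  moreover have "(LINT q|lborel. gauss_rate x q * gauss x q * f q) + (LINT q|lborel. gauss x q * g q) + 0 = 0"
  proof -
    have "integrable lborel (\<lambda>q. gauss_rate x q * gauss x q * f q)"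
    proof (rule Bochner_Integration.integrable_bound[OF weighted[of f]])
      show "AE q in lborel. norm (gauss_rate x q * gauss x q * f q) \<le> norm (K * (1 + q\<^sup>2) * cmod (f q))"
      proof (intro AE_I2)
        fix q
        show "norm (gauss_rate x q * gauss x q * f q) \<le> norm (K * (1 + q\<^sup>2) * cmod (f q))"
          using mult_right_mono[OF K2[OF \<open>x \<in> cball x d\<close>, of q], of "cmod (f q)"] K0
          by (simp add: norm_mult abs_mult)
      qed
      show "(\<lambda>q. gauss_rate x q * gauss x q * f q) \<in> borel_measurable lborel"
      proof -
        have "continuous_on UNIV (\<lambda>q. gauss_rate x q * gauss x q * f q)"
          unfolding gauss_rate_def using schwartz_continuous[OF Sf] continuous_on_gauss[of x]
          by (intro continuous_intros)
        from borel_measurable_continuous_onI[OF this] show ?thesis by simp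
      qed
    qed (use Sf in \<open>auto intro: fast_decay_intros\<close>)
    moreover have "integrable lborel (\<lambda>q. gauss x q * g q)"
      by (intro fast_decay_integrable mult_decay0 g_decay)
    ultimately show ?thesis
      using gauss_ham_symmetric[OF x Sf, folded g_def] by (simp add: Bochner_Integration.integral_add)
  qed
  ultimately have "((\<lambda>h. (LINT q|lborel. (gauss (x + h) q - gauss x q) / h * f q)
       + (LINT q|lborel. gauss (x + h) q * g q) + (LINT q|lborel. gauss (x + h) q * \<rho> h q)) \<longlongrightarrow> 0) (at 0)"
    by simp
  moreover have "\<forall>\<^sub>F h in at 0. (LINT q|lborel. (gauss (x + h) q - gauss x q) / h * f q)
       + (LINT q|lborel. gauss (x + h) q * g q) + (LINT q|lborel. gauss (x + h) q * \<rho> h q)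
     = (?J (x + h) - ?J x) / h"
    using near
  proof eventually_elim
    case (elim h)
    have fd: "fast_decay f" using Sf by (rule schwartz_fast_decay)
    have i0: "integrable lborel (\<lambda>q. gauss (x + h) q * f q)" "integrable lborel (\<lambda>q. gauss x q * f q)"
      using elim by (auto intro!: fast_decay_integrable mult_decay mult_decay0 fd)
    have iu: "integrable lborel (\<lambda>q. gauss (x + h) q * u (x + h) q)" "integrable lborel (\<lambda>q. gauss x q * u x q)"
      using elim i0(2) fast_decay_integrable[OF mult_decay[OF schwartz_fast_decay[OF S[OF in_I]]]]
      by (auto simp: f_def)
    have i1: "integrable lborel (\<lambda>q. (gauss (x + h) q - gauss x q) / h * f q)"
    proof -
      have "integrable lborel (\<lambda>q. (gauss (x + h) q * f q - gauss x q * f q) / complex_of_real h)"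
        by (intro integrable_divide_zero Bochner_Integration.integrable_diff i0)
      then show ?thesis by (simp add: algebra_simps)
    qed
    have i2: "integrable lborel (\<lambda>q. gauss (x + h) q * g q)"
      using elim by (intro fast_decay_integrable mult_decay g_decay) auto
    have i3: "integrable lborel (\<lambda>q. gauss (x + h) q * \<rho> h q)"
      using elim by (intro fast_decay_integrable mult_decay \<rho>_decay) auto
    have "(LINT q|lborel. (gauss (x + h) q - gauss x q) / h * f q)
       + (LINT q|lborel. gauss (x + h) q * g q) + (LINT q|lborel. gauss (x + h) q * \<rho> h q)
       = (LINT q|lborel. (gauss (x + h) q - gauss x q) / h * f q
           + gauss (x + h) q * g q + gauss (x + h) q * \<rho> h q)"
      by (simp only: Bochner_Integration.integral_add i1 i2 i3 Bochner_Integration.integrable_add)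
    also have "\<dots> = (LINT q|lborel. (gauss (x + h) q * u (x + h) q - gauss x q * u x q) / complex_of_real h)"
      using elim by (intro Bochner_Integration.integral_cong) (auto simp: \<rho>_def f_def g_def field_simps)
    also have "\<dots> = (?J (x + h) - ?J x) / h"
      by (simp add: Bochner_Integration.integral_diff[OF iu])
    finally show ?case .
  qed
  ultimately have "((\<lambda>h. (?J (x + h) - ?J x) / complex_of_real h) \<longlongrightarrow> 0) (at 0)"
    by (rule Lim_transform_eventually)
  then have "((\<lambda>h. norm (?J (x + h) - ?J x) / norm h) \<longlongrightarrow> 0) (at 0)"
    by (drule_tac tendsto_norm_zero) (simp add: norm_divide)
  then show ?thesis
    by (simp add: has_vector_derivative_def has_derivative_at)
qed

lemma pairing_constant:
  assumes "is_interval I"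
    and "\<And>y. y \<in> I \<Longrightarrow> schwartz (u y)"
    and "\<And>x. x \<in> I \<Longrightarrow> ((\<lambda>h. L2norm (\<lambda>q. (u (x + h) q - u x q) / complex_of_real h
       + \<i> * ham \<kappa> x (u x) q)) \<longlongrightarrow> 0) (at 0)"
    and "x \<in> I" "y \<in> I"
  shows "(LINT q|lborel. gauss x q * u x q) = (LINT q|lborel. gauss y q * u y q)"
proof -
  have "convex I" using assms(1) by (simp add: is_interval_convex)
  have "\<exists>c. \<forall>x\<in>I. (LINT q|lborel. gauss x q * u x q) = c"
  proof (rule has_derivative_zero_constant[OF \<open>convex I\<close>])
    fix x assume "x \<in> I"
    from pairing_has_derivative_0[OF this assms(2) assms(3)[OF this]]
    show "((\<lambda>x. LINT q|lborel. gauss x q * u x q) has_derivative (\<lambda>h. 0)) (at x within I)"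
      by (auto simp: has_vector_derivative_def intro: has_derivative_at_withinI)
  qed
  then show ?thesis using assms(4,5) by metis
qed

end

section \<open>Approximate identities, zeros and the Pruefer angle\<close>

text \<open>The substitution \<open>q = a + \<sigma> n * y\<close> moves the dependence on
  \<open>n\<close> out of the density and into the argument of \<open>f\<close>. Continuity then
  gives the pointwise limit and \<open>B\<close> times the standard density is a majorant.\<close>

lemma normal_density_approx_identity:
  fixes f :: "real \<Rightarrow> complex"
  assumes cont: "continuous_on UNIV f" and B: "\<And>x. cmod (f x) \<le> B"
    and \<sigma>: "\<And>n. \<sigma> n > 0" "\<sigma> \<longlonglongrightarrow> 0"
  shows "(\<lambda>n. LINT q|lborel. complex_of_real (normal_density a (\<sigma> n) q) * f q) \<longlonglongrightarrow> f a"
proof -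
  have [measurable]: "f \<in> borel_measurable borel"
    using cont by (rule borel_measurable_continuous_onI)
  have resc: "(LINT q|lborel. complex_of_real (normal_density a (\<sigma> n) q) * f q)
      = (LINT y|lborel. complex_of_real (std_normal_density y) * f (a + \<sigma> n * y))" for n
  proof -
    have "(LINT q|lborel. complex_of_real (normal_density a (\<sigma> n) q) * f q) =
       \<bar>\<sigma> n\<bar> *\<^sub>R (LINT y|lborel. complex_of_real (normal_density a (\<sigma> n) (a + \<sigma> n * y)) * f (a + \<sigma> n * y))"
      using \<sigma>(1)[of n] by (intro lborel_integral_real_affine) simp
    also have "\<dots> = (LINT y|lborel. \<bar>\<sigma> n\<bar> *\<^sub>R (complex_of_real (normal_density a (\<sigma> n) (a + \<sigma> n * y)) * f (a + \<sigma> n * y)))"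
      by simp
    also have "\<dots> = (LINT y|lborel. complex_of_real (std_normal_density y) * f (a + \<sigma> n * y))"
    proof (rule Bochner_Integration.integral_cong[OF refl])
      fix y
      have "\<sigma> n * normal_density a (\<sigma> n) (a + \<sigma> n * y) = std_normal_density y"
        using \<sigma>(1)[of n] by (simp add: normal_density_def real_sqrt_mult power_mult_distrib)
      then show "\<bar>\<sigma> n\<bar> *\<^sub>R (complex_of_real (normal_density a (\<sigma> n) (a + \<sigma> n * y)) * f (a + \<sigma> n * y))
         = complex_of_real (std_normal_density y) * f (a + \<sigma> n * y)"
        using \<sigma>(1)[of n] by (simp add: scaleR_conv_of_real flip: of_real_mult mult.assoc)
    qed
    finally show ?thesis .
  qed
  have "(\<lambda>n. LINT y|lborel. complex_of_real (std_normal_density y) * f (a + \<sigma> n * y))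
      \<longlonglongrightarrow> (LINT y|lborel. complex_of_real (std_normal_density y) * f a)"
  proof (rule integral_dominated_convergence[where w = "\<lambda>y. std_normal_density y * B"])
    show "integrable lborel (\<lambda>y. std_normal_density y * B)" by simp
    show "AE y in lborel. (\<lambda>n. complex_of_real (std_normal_density y) * f (a + \<sigma> n * y))
        \<longlonglongrightarrow> complex_of_real (std_normal_density y) * f a"
    proof (intro AE_I2 tendsto_mult tendsto_const)
      fix y
      have "(\<lambda>n. a + \<sigma> n * y) \<longlonglongrightarrow> a" by (rule tendsto_eq_intros \<sigma> refl | simp)+
      with cont show "(\<lambda>n. f (a + \<sigma> n * y)) \<longlonglongrightarrow> f a"
        by (auto simp: continuous_on_eq_continuous_at intro: isCont_tendsto_compose)
    qed
    show "AE y in lborel. cmod (complex_of_real (std_normal_density y) * f (a + \<sigma> n * y))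
        \<le> std_normal_density y * B" for n
      by (intro AE_I2) (auto simp: norm_mult intro!: mult_left_mono B)
  qed measurable
  also have "(LINT y|lborel. complex_of_real (std_normal_density y) * f a) = f a"
    by (simp add: integral_complex_of_real)
  finally show ?thesis by (simp add: resc)
qed

text \<open>\<phi> maps the counted set bijectively onto the integers in the interval open at
  \<open>\<phi> p\<close> and closed at \<open>\<phi> q\<close>: injectivity is monotonicity,
  surjectivity is the intermediate value theorem. The half-open interval is the reason why a plain
  difference of floors counts correctly, even if an endpoint value is an integer.\<close>

lemma card_integer_values:
  fixes \<phi> :: "real \<Rightarrow> real"
  assumes cont: "continuous_on {p..q} \<phi>" and mono: "strict_mono_on {p..q} \<phi>" and "p \<le> q"
  shows "int (card {\<tau>. p < \<tau> \<and> \<tau> \<le> q \<and> \<phi> \<tau> \<in> \<int>}) = \<lfloor>\<phi> q\<rfloor> - \<lfloor>\<phi> p\<rfloor>"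
proof -
  let ?A = "{\<tau>. p < \<tau> \<and> \<tau> \<le> q \<and> \<phi> \<tau> \<in> \<int>}"
  have "inj_on \<phi> ?A"
    using strict_mono_on_imp_inj_on[OF mono] by (rule inj_on_subset) auto
  moreover have "\<phi> ` ?A = real_of_int ` {\<lfloor>\<phi> p\<rfloor> + 1..\<lfloor>\<phi> q\<rfloor>}"
  proof (intro equalityI subsetI)
    fix y assume "y \<in> \<phi> ` ?A"
    then obtain \<tau> where \<tau>: "p < \<tau>" "\<tau> \<le> q" "\<phi> \<tau> \<in> \<int>" "y = \<phi> \<tau>" by auto
    then obtain k where k: "\<phi> \<tau> = real_of_int k" by (auto elim: Ints_cases)
    have "\<phi> p < \<phi> \<tau>" using \<tau> by (intro strict_mono_onD[OF mono]) auto
    moreover have "\<phi> \<tau> \<le> \<phi> q"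
      using strict_mono_on_leD[OF mono, of \<tau> q] \<tau> by auto
    ultimately have "\<lfloor>\<phi> p\<rfloor> + 1 \<le> k" "k \<le> \<lfloor>\<phi> q\<rfloor>"
      using k by linarith+
    then show "y \<in> real_of_int ` {\<lfloor>\<phi> p\<rfloor> + 1..\<lfloor>\<phi> q\<rfloor>}"
      using \<tau>(4) k by auto
  next
    fix y assume "y \<in> real_of_int ` {\<lfloor>\<phi> p\<rfloor> + 1..\<lfloor>\<phi> q\<rfloor>}"
    then obtain k where k: "y = real_of_int k" "\<lfloor>\<phi> p\<rfloor> + 1 \<le> k" "k \<le> \<lfloor>\<phi> q\<rfloor>" by auto
    then have "\<phi> p < y" "y \<le> \<phi> q" by linarith+
    then obtain \<tau> where \<tau>: "p \<le> \<tau>" "\<tau> \<le> q" "\<phi> \<tau> = y"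
      using IVT'[of \<phi> p y q] cont \<open>p \<le> q\<close> by auto
    with \<open>\<phi> p < y\<close> have "p < \<tau>" by (cases "p = \<tau>") auto
    with \<tau> k(1) have "\<tau> \<in> ?A" by auto
    with \<tau>(3) show "y \<in> \<phi> ` ?A" by blast
  qed
  ultimately have "card ?A = card (real_of_int ` {\<lfloor>\<phi> p\<rfloor> + 1..\<lfloor>\<phi> q\<rfloor>})"
    using card_image by metis
  also have "\<dots> = card {\<lfloor>\<phi> p\<rfloor> + 1..\<lfloor>\<phi> q\<rfloor>}"
    by (intro card_image) (auto simp: inj_on_def)
  finally have "card ?A = nat (\<lfloor>\<phi> q\<rfloor> - \<lfloor>\<phi> p\<rfloor>)" by simp
  moreover have "\<lfloor>\<phi> p\<rfloor> \<le> \<lfloor>\<phi> q\<rfloor>"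
    using strict_mono_on_leD[OF mono, of p q] \<open>p \<le> q\<close> by (intro floor_mono) auto
  ultimately show ?thesis by simp
qed

text \<open>A difference of floors changes sign when the two times are exchanged, just as
  \<open>index_fun\<close> does, so the same formula covers both time orders.\<close>

lemma index_fun_eq_floor:
  fixes \<phi> :: "real \<Rightarrow> real"
  assumes J: "is_interval J" "t \<in> J" "t0 \<in> J"
    and cont: "continuous_on J \<phi>" and mono: "strict_mono_on J \<phi>"
    and zero: "\<And>x. x \<in> J \<Longrightarrow> u x = 0 \<longleftrightarrow> \<phi> x \<in> \<int>"
  shows "index_fun u t t0 = \<lfloor>\<phi> t\<rfloor> - \<lfloor>\<phi> t0\<rfloor>"
proof -
  have *: "int (card {\<tau>. p < \<tau> \<and> \<tau> \<le> q \<and> u \<tau> = 0}) = \<lfloor>\<phi> q\<rfloor> - \<lfloor>\<phi> p\<rfloor>"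
    if "p \<in> J" "q \<in> J" "p \<le> q" for p q
  proof -
    have sub: "{p..q} \<subseteq> J"
      using J(1) that by (metis interval_subset_is_interval cbox_interval)
    then have "{\<tau>. p < \<tau> \<and> \<tau> \<le> q \<and> u \<tau> = 0} = {\<tau>. p < \<tau> \<and> \<tau> \<le> q \<and> \<phi> \<tau> \<in> \<int>}"
      using zero[OF subsetD[OF sub]] by auto
    then show ?thesis
      using card_integer_values[of p q \<phi>] sub that cont mono
      by (simp add: continuous_on_subset monotone_on_subset)
  qed
  show ?thesis
    using *[of t0 t] *[of t t0] J by (auto simp: index_fun_def)
qed

text \<open>By the Wronskian a polar angle of \<open>(c0, s0)\<close> must have derivative
  \<open>1 / (c0\<^sup>2 + s0\<^sup>2)\<close>. It is therefore defined by integration, which avoids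
  any choice of branches, and the polar form is verified afterwards. The closed interval serves to
  obtain the antiderivative; the open one makes its derivative two-sided.\<close>

lemma pruefer_angle:
  fixes c0 c1 s0 s1 :: "real \<Rightarrow> real"
  assumes t0: "t0 \<in> {a<..<b}"
    and deriv: "\<And>x. x \<in> {a..b} \<Longrightarrow> (c0 has_real_derivative c1 x) (at x)"
      "\<And>x. x \<in> {a..b} \<Longrightarrow> (s0 has_real_derivative s1 x) (at x)"
    and wronskian: "\<And>x. x \<in> {a..b} \<Longrightarrow> c0 x * s1 x - s0 x * c1 x = 1"
    and init: "c0 t0 = 1" "s0 t0 = 0"
  obtains \<theta> where "\<theta> t0 = 0"
    "\<And>x. x \<in> {a<..<b} \<Longrightarrow> (\<theta> has_real_derivative 1 / ((c0 x)\<^sup>2 + (s0 x)\<^sup>2)) (at x)"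
    "\<And>x. x \<in> {a<..<b} \<Longrightarrow> c0 x = sqrt ((c0 x)\<^sup>2 + (s0 x)\<^sup>2) * cos (\<theta> x)"
    "\<And>x. x \<in> {a<..<b} \<Longrightarrow> s0 x = sqrt ((c0 x)\<^sup>2 + (s0 x)\<^sup>2) * sin (\<theta> x)"
proof -
  define N where "N x = (c0 x)\<^sup>2 + (s0 x)\<^sup>2" for x
  have N: "N x > 0" if "x \<in> {a..b}" for x
    using wronskian[OF that] by (auto simp: N_def sum_power2_gt_zero_iff)
  have "continuous_on {a..b} c0" "continuous_on {a..b} s0"
    using deriv DERIV_isCont continuous_at_imp_continuous_on by blast+
  then have "continuous_on {a..b} (\<lambda>x. 1 / N x)"
    using less_imp_neq[OF N] unfolding N_def by (intro continuous_intros) force+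
  then obtain g where g: "\<And>x. x \<in> {a..b} \<Longrightarrow> (g has_vector_derivative 1 / N x) (at x within {a..b})"
    using antiderivative_continuous[of a b "\<lambda>x. 1 / N x"] by blast
  define \<theta> where "\<theta> x = g x - g t0" for x
  have \<theta>: "(\<theta> has_real_derivative 1 / N x) (at x)" if "x \<in> {a<..<b}" for x
  proof -
    have "at x within {a..b} = at x"
      using that by (intro at_within_interior) (auto simp: interior_atLeastAtMost_real)
    then have "(g has_real_derivative 1 / N x) (at x)"
      using g[of x] that by (simp add: has_real_derivative_iff_has_vector_derivative)
    then show ?thesis
      unfolding \<theta>_def by (auto intro!: derivative_eq_intros)
  qed
  define m where "m x = c0 x * c1 x + s0 x * s1 x" for x
  \<comment> \<open>Both components of the solution in the frame rotated by \<open>\<theta>\<close> satisfy \<open>y' = (m / N) y\<close>, as does \<open>sqrt N\<close>.\<close>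
  have lin: "y x = y t0 * sqrt (N x)"
    if y: "\<And>x. x \<in> {a<..<b} \<Longrightarrow> (y has_real_derivative m x / N x * y x) (at x)" and x: "x \<in> {a<..<b}" for y x
  proof -
    have "((\<lambda>x. y x / sqrt (N x)) has_real_derivative 0) (at x)" if x: "x \<in> {a<..<b}" for x
    proof -
      have N': "(N has_real_derivative 2 * m x) (at x)"
        unfolding N_def[abs_def] using x
        by (auto intro!: derivative_eq_intros deriv simp: m_def)
      have Nx: "N x > 0" using N x by simp
      then have sq: "sqrt (N x) * sqrt (N x) = N x" "sqrt (N x) > 0" by auto
      have "((\<lambda>x. y x / sqrt (N x)) has_real_derivative
         (m x / N x * y x * sqrt (N x) - y x * (2 * m x * (inverse (sqrt (N x)) / 2))) / (sqrt (N x) * sqrt (N x))) (at x)"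
        using Nx sq(2) by (intro DERIV_divide y[OF x] DERIV_chain2[where f = sqrt, OF DERIV_real_sqrt N', THEN DERIV_cong]) auto
      moreover have "m x / N x * y x * sqrt (N x) - y x * (2 * m x * (inverse (sqrt (N x)) / 2)) = 0"
      proof -
        have "sqrt (N x) / N x = inverse (sqrt (N x))"
          using sq by (metis Nx inverse_eq_divide less_imp_le real_div_sqrt sqrt_divide_self_eq)
        moreover have "m x / N x * y x * sqrt (N x) = m x * y x * (sqrt (N x) / N x)" by simp
        ultimately show ?thesis by simp
      qed
      ultimately show ?thesis by simp
    qed
    then have "y x / sqrt (N x) = y t0 / sqrt (N t0)"
      using has_field_derivative_zero_constant[of "{a<..<b}" "\<lambda>x. y x / sqrt (N x)"] x t0
      by (metis convex_real_interval(8) has_field_derivative_at_within)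
    moreover have "sqrt (N t0) = 1" by (simp add: N_def init)
    moreover have "sqrt (N x) > 0" using N[of x] x by simp
    ultimately show ?thesis by (simp add: field_simps)
  qed
  define A where "A x = c0 x * cos (\<theta> x) + s0 x * sin (\<theta> x)" for x
  define B where "B x = s0 x * cos (\<theta> x) - c0 x * sin (\<theta> x)" for x
  have A': "(A has_real_derivative m x / N x * A x) (at x)" if x: "x \<in> {a<..<b}" for x
  proof -
    have Nx: "N x > 0" using N x by simp
    have w: "c0 x * s1 x = 1 + s0 x * c1 x" using wronskian[of x] x by simp
    have "(A has_real_derivative c1 x * cos (\<theta> x) + s1 x * sin (\<theta> x) + B x / N x) (at x)"
      unfolding A_def[abs_def] B_def using x
      by (auto intro!: derivative_eq_intros deriv \<theta> simp: algebra_simps add_divide_distrib diff_divide_distrib)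
    \<comment> \<open>The Wronskian, whose value is 1, is inserted as a factor of \<open>B x\<close>
      to make the identity homogeneous; it then holds by expansion alone.\<close>
    moreover have "N x * (c1 x * cos (\<theta> x) + s1 x * sin (\<theta> x)) + B x * (c0 x * s1 x - s0 x * c1 x) = m x * A x"
      unfolding A_def B_def N_def m_def by (simp add: algebra_simps power2_eq_square)
    then have "c1 x * cos (\<theta> x) + s1 x * sin (\<theta> x) + B x / N x = m x / N x * A x"
      using Nx w by (simp add: field_simps)
    ultimately show ?thesis by simp
  qed
  have B': "(B has_real_derivative m x / N x * B x) (at x)" if x: "x \<in> {a<..<b}" for x
  proof -
    have Nx: "N x > 0" using N x by simp
    have w: "c0 x * s1 x = 1 + s0 x * c1 x" using wronskian[of x] x by simp
    have "(B has_real_derivative s1 x * cos (\<theta> x) - c1 x * sin (\<theta> x) - A x / N x) (at x)"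
      unfolding B_def[abs_def] A_def using x
      by (auto intro!: derivative_eq_intros deriv \<theta> simp: algebra_simps add_divide_distrib diff_divide_distrib)
    moreover have "N x * (s1 x * cos (\<theta> x) - c1 x * sin (\<theta> x)) - A x * (c0 x * s1 x - s0 x * c1 x) = m x * B x"
      unfolding A_def B_def N_def m_def by (simp add: algebra_simps power2_eq_square)
    then have "s1 x * cos (\<theta> x) - c1 x * sin (\<theta> x) - A x / N x = m x / N x * B x"
      using Nx w by (simp add: field_simps)
    ultimately show ?thesis by simp
  qed
  have \<theta>0: "\<theta> t0 = 0" by (simp add: \<theta>_def)
  \<comment> \<open>Both coordinates solve the same linear equation as \<open>sqrt (N x)\<close>,
    and their values at \<open>t0\<close> are 1 and 0; the solution therefore stays on the first
    axis of the rotated frame.\<close>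
  have AB: "A x = sqrt (N x)" "B x = 0" if "x \<in> {a<..<b}" for x
    using lin[OF A' that] lin[OF B' that] \<theta>0 init by (auto simp: A_def B_def)
  have "c0 x = A x * cos (\<theta> x) - B x * sin (\<theta> x)" "s0 x = A x * sin (\<theta> x) + B x * cos (\<theta> x)" for x
  proof -
    have "A x * cos (\<theta> x) - B x * sin (\<theta> x) = c0 x * ((sin (\<theta> x))\<^sup>2 + (cos (\<theta> x))\<^sup>2)"
      unfolding A_def B_def by algebra
    then show "c0 x = A x * cos (\<theta> x) - B x * sin (\<theta> x)" by simp
    have "A x * sin (\<theta> x) + B x * cos (\<theta> x) = s0 x * ((sin (\<theta> x))\<^sup>2 + (cos (\<theta> x))\<^sup>2)"
      unfolding A_def B_def by algebra
    then show "s0 x = A x * sin (\<theta> x) + B x * cos (\<theta> x)" by simp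
  qed
  with AB have polar: "c0 x = sqrt (N x) * cos (\<theta> x)" "s0 x = sqrt (N x) * sin (\<theta> x)" if "x \<in> {a<..<b}" for x
    using that by force+
  show thesis
    by (rule that[of \<theta>, folded N_def]) (fact \<theta>0 | erule \<theta> | erule polar)+
qed

section \<open>The Gaussian concentrating at a point and its limit\<close>

lemma has_vector_derivative_divide_field:
  fixes f g :: "real \<Rightarrow> complex"
  assumes f: "(f has_vector_derivative f') (at x)" and g: "(g has_vector_derivative g') (at x)"
    and nz: "g x \<noteq> 0"
  shows "((\<lambda>x. f x / g x) has_vector_derivative (f' * g x - f x * g') / (g x)\<^sup>2) (at x)"
proof -
  have "((inverse \<circ> g) has_vector_derivative g' * - (inverse (g x) ^ Suc (Suc 0))) (at x)"
    by (rule field_vector_diff_chain_at[OF g DERIV_inverse[OF nz]])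
  from has_vector_derivative_mult[OF f this] show ?thesis
    by (simp add: divide_inverse) (use nz in \<open>simp add: field_simps power2_eq_square\<close>)
qed

lemma cis_has_vector_derivative:
  assumes "(g has_real_derivative g') (at x)"
  shows "((\<lambda>x. cis (g x)) has_vector_derivative \<i> * g' * cis (g x)) (at x)"
proof -
  have "((\<lambda>x. \<i> * complex_of_real (g x)) has_vector_derivative \<i> * g') (at x)"
    using assms by (intro has_vector_derivative_mult_right has_vector_derivative_of_real)
       (simp add: has_real_derivative_iff_has_vector_derivative)
  from field_vector_diff_chain_at[OF this DERIV_exp] show ?thesis
    by (simp add: cis_conv_exp comp_def)
qed

lemma inverse_cis_mult: "1 / (cis x * complex_of_real y) = cis (- x) / complex_of_real y"
  using cis_inverse[of x] by (metis divide_divide_eq_left inverse_eq_divide)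

lemma powr_minus_half: "x > 0 \<Longrightarrow> x powr (-1/2) = 1 / sqrt x" for x :: real
  using powr_minus_divide[of x "1/2"] by (simp add: powr_half_sqrt)

text \<open>The two terms with \<kappa> cancel in the derivative. Besides normalizing the
  fundamental pair, this relates solutions with different initial times by comparing the values at
  both times.\<close>

lemma wronskian_constant:
  fixes f f1 g g1 \<kappa> :: "real \<Rightarrow> real"
  assumes "is_interval I" "x \<in> I" "y \<in> I"
    and "\<And>x. x \<in> I \<Longrightarrow> (f has_real_derivative f1 x) (at x)"
    and "\<And>x. x \<in> I \<Longrightarrow> (f1 has_real_derivative - \<kappa> x * f x) (at x)"
    and "\<And>x. x \<in> I \<Longrightarrow> (g has_real_derivative g1 x) (at x)"
    and "\<And>x. x \<in> I \<Longrightarrow> (g1 has_real_derivative - \<kappa> x * g x) (at x)"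
  shows "f x * g1 x - g x * f1 x = f y * g1 y - g y * f1 y"
proof -
  have "\<exists>k. \<forall>z\<in>I. f z * g1 z - g z * f1 z = k"
  proof (rule has_field_derivative_zero_constant)
    show "convex I" using assms(1) by (simp add: is_interval_convex)
    fix z assume z: "z \<in> I"
    have "((\<lambda>x. f x * g1 x - g x * f1 x) has_real_derivative
        (f1 z * g1 z + (- \<kappa> z * g z) * f z) - (g1 z * f1 z + (- \<kappa> z * f z) * g z)) (at z)"
      by (intro DERIV_diff DERIV_mult assms(4-7) z)
    then show "((\<lambda>x. f x * g1 x - g x * f1 x) has_real_derivative 0) (at z within I)"
      by (simp add: mult_ac has_field_derivative_at_within)
  qed
  with assms(2,3) show ?thesis by auto
qed

text \<open>The fundamental pair with initial time \<open>t0\<close> together with its angle, on an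
  interval around both times. The target \<open>t\<close> is a fixed parameter because the Gaussian
  solution is prescribed there and followed back to \<open>t0\<close>.\<close>

locale pruefer_pair =
  fixes J :: "real set" and \<kappa> c0 c1 s0 s1 \<theta> :: "real \<Rightarrow> real" and t t0 :: real
  assumes J: "is_interval J" "open J" "t \<in> J" "t0 \<in> J"
    and \<kappa>_cont: "continuous_on J \<kappa>"
    and c0_deriv: "\<And>x. x \<in> J \<Longrightarrow> (c0 has_real_derivative c1 x) (at x)"
    and c1_deriv: "\<And>x. x \<in> J \<Longrightarrow> (c1 has_real_derivative - \<kappa> x * c0 x) (at x)"
    and s0_deriv: "\<And>x. x \<in> J \<Longrightarrow> (s0 has_real_derivative s1 x) (at x)"
    and s1_deriv: "\<And>x. x \<in> J \<Longrightarrow> (s1 has_real_derivative - \<kappa> x * s0 x) (at x)"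
    and wronskian: "\<And>x. x \<in> J \<Longrightarrow> c0 x * s1 x - s0 x * c1 x = 1"
    and init: "c0 t0 = 1" "c1 t0 = 0" "s0 t0 = 0" "s1 t0 = 1"
    and \<theta>_t0: "\<theta> t0 = 0"
    and \<theta>_deriv: "\<And>x. x \<in> J \<Longrightarrow> (\<theta> has_real_derivative 1 / ((c0 x)\<^sup>2 + (s0 x)\<^sup>2)) (at x)"
    and c0_polar: "\<And>x. x \<in> J \<Longrightarrow> c0 x = sqrt ((c0 x)\<^sup>2 + (s0 x)\<^sup>2) * cos (\<theta> x)"
    and s0_polar: "\<And>x. x \<in> J \<Longrightarrow> s0 x = sqrt ((c0 x)\<^sup>2 + (s0 x)\<^sup>2) * sin (\<theta> x)"
begin

section \<open>Zeros of the fundamental pair and the square root of the complex solution\<close>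

lemma norm_pos: "x \<in> J \<Longrightarrow> (c0 x)\<^sup>2 + (s0 x)\<^sup>2 > 0"
  using wronskian[of x] by (auto simp: sum_power2_gt_zero_iff)

lemma \<theta>_continuous: "continuous_on J \<theta>"
  using \<theta>_deriv DERIV_isCont continuous_at_imp_continuous_on by blast

lemma \<theta>_strict_mono: "strict_mono_on J \<theta>"
proof (rule strict_mono_onI)
  fix x y assume xy: "x \<in> J" "y \<in> J" "x < y"
  then have "{x..y} \<subseteq> J"
    using J(1) by (metis interval_subset_is_interval cbox_interval)
  then show "\<theta> x < \<theta> y"
    using \<theta>_deriv norm_pos by (intro DERIV_pos_imp_increasing[OF xy(3)]) (force intro!: divide_pos_pos)
qed

lemma index_fun_s0: "index_fun s0 t t0 = \<lfloor>\<theta> t / pi\<rfloor>"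
proof -
  have "index_fun s0 t t0 = \<lfloor>\<theta> t / pi\<rfloor> - \<lfloor>\<theta> t0 / pi\<rfloor>"
  proof (rule index_fun_eq_floor[OF J(1,3,4)])
    show "continuous_on J (\<lambda>x. \<theta> x / pi)"
      by (intro continuous_intros \<theta>_continuous) simp
    show "strict_mono_on J (\<lambda>x. \<theta> x / pi)"
      using \<theta>_strict_mono by (auto simp: strict_mono_on_def divide_strict_right_mono)
    fix x assume x: "x \<in> J"
    have "s0 x = 0 \<longleftrightarrow> sin (\<theta> x) = 0"
      using s0_polar[OF x] norm_pos[OF x] by (metis mult_eq_0_iff order_less_irrefl real_sqrt_eq_zero_cancel_iff)
    also have "\<dots> \<longleftrightarrow> \<theta> x / pi \<in> \<int>"
      unfolding sin_zero_iff_int2 by (auto simp: Ints_def field_simps image_iff)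
    finally show "s0 x = 0 \<longleftrightarrow> \<theta> x / pi \<in> \<int>" .
  qed
  then show ?thesis by (simp add: \<theta>_t0)
qed

lemma index_fun_c0: "index_fun c0 t t0 = \<lfloor>\<theta> t / pi + 1 / 2\<rfloor>"
proof -
  have "index_fun c0 t t0 = \<lfloor>\<theta> t / pi + 1 / 2\<rfloor> - \<lfloor>\<theta> t0 / pi + 1 / 2\<rfloor>"
  proof (rule index_fun_eq_floor[OF J(1,3,4)])
    show "continuous_on J (\<lambda>x. \<theta> x / pi + 1 / 2)"
      by (intro continuous_intros \<theta>_continuous) simp
    show "strict_mono_on J (\<lambda>x. \<theta> x / pi + 1 / 2)"
      using \<theta>_strict_mono by (auto simp: strict_mono_on_def divide_strict_right_mono)
    fix x assume x: "x \<in> J"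
    have "c0 x = 0 \<longleftrightarrow> cos (\<theta> x) = 0"
      using c0_polar[OF x] norm_pos[OF x] by (metis mult_eq_0_iff order_less_irrefl real_sqrt_eq_zero_cancel_iff)
    also have "\<dots> \<longleftrightarrow> sin (\<theta> x + pi / 2) = 0"
      by (simp add: sin_add)
    also have "\<dots> \<longleftrightarrow> \<theta> x / pi + 1 / 2 \<in> \<int>"
      unfolding sin_zero_iff_int2 by (auto simp: Ints_def field_simps image_iff)
    finally show "c0 x = 0 \<longleftrightarrow> \<theta> x / pi + 1 / 2 \<in> \<int>" .
  qed
  then show ?thesis by (simp add: \<theta>_t0)
qed

text \<open>\<open>Z \<epsilon>\<close> is the solution with \<open>Z \<epsilon> t = - \<i> * \<epsilon>\<close> and derivative \<open>-1\<close> at \<open>t\<close>, \<open>Y\<close> the one with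
  \<open>Y t = 1\<close> and derivative \<open>0\<close> at \<open>t\<close>; in the notation of the paper, \<open>Z \<epsilon> x = s(t,x) - \<i> \<epsilon> c(x,t)\<close>.\<close>
definition Y :: "real \<Rightarrow> real" where "Y x = s1 t * c0 x - c1 t * s0 x"

definition Z :: "real \<Rightarrow> real \<Rightarrow> complex" where
  "Z \<epsilon> x = Complex (s0 t * c0 x - c0 t * s0 x) (- \<epsilon> * Y x)"

definition Z1 :: "real \<Rightarrow> real \<Rightarrow> complex" where
  "Z1 \<epsilon> x = Complex (s0 t * c1 x - c0 t * s1 x) (- \<epsilon> * (s1 t * c1 x - c1 t * s1 x))"

text \<open>The continuous branch of the square root of \<open>Z \<epsilon>\<close>: after rotating back by \<open>phase\<close>, the curve
  \<open>Z \<epsilon>\<close> stays in the right half plane (for \<open>small \<epsilon>\<close>), where \<open>csqrt\<close> is smooth.\<close>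
definition phase :: "real \<Rightarrow> real" where "phase x = \<theta> t - \<theta> x - pi / 2"

definition Zroot :: "real \<Rightarrow> real \<Rightarrow> complex" where
  "Zroot \<epsilon> x = cis (phase x / 2) * csqrt (Z \<epsilon> x * cis (- phase x))"

text \<open>Half the derivative of \<open>c0\<^sup>2 + s0\<^sup>2\<close> at \<open>t\<close>; it
  measures how far \<open>Y\<close> is tilted against the frame given by the angle.\<close>

definition slope :: real where "slope = c0 t * c1 t + s0 t * s1 t"

text \<open>The quadratic form \<open>M * \<sigma>\<^sup>2 + \<epsilon> * slope * \<sigma> * \<tau>
  + \<epsilon> * \<tau>\<^sup>2\<close> with \<open>M = (c0 t)\<^sup>2 + (s0 t)\<^sup>2\<close> is
  definite as soon as \<open>\<epsilon> * slope\<^sup>2 < 4 * M\<close>. The bound used here leaves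
  room and turns definiteness into one completed square.\<close>

definition small :: "real \<Rightarrow> bool" where
  "small \<epsilon> \<longleftrightarrow> 0 < \<epsilon> \<and> \<epsilon> * slope\<^sup>2 \<le> (c0 t)\<^sup>2 + (s0 t)\<^sup>2"

text \<open>If \<open>\<epsilon> * Y x\<close> were equal to
  \<open>c0 t * c0 x + s0 t * s0 x\<close>, then \<open>phase x\<close> would be an exact argument
  of \<open>Z \<epsilon> x\<close>. In general the curve is a distorted copy of that one, and the
  claim is that the distortion changes the argument by less than pi/2.\<close>

lemma Re_Z_rotated_pos:
  assumes "small \<epsilon>" and x: "x \<in> J"
  shows "Re (Z \<epsilon> x * cis (- phase x)) > 0"
proof -
  \<comment> \<open>Up to positive factors the real part is a quadratic form in \<open>\<sigma>\<close> and \<open>\<tau>\<close>, definite for \<open>small \<epsilon>\<close>.\<close>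
  define \<sigma> where "\<sigma> = s0 t * c0 x - c0 t * s0 x"
  define \<tau> where "\<tau> = c0 t * c0 x + s0 t * s0 x"
  define n where "n = sqrt ((c0 t)\<^sup>2 + (s0 t)\<^sup>2) * sqrt ((c0 x)\<^sup>2 + (s0 x)\<^sup>2)"
  define M where "M = (c0 t)\<^sup>2 + (s0 t)\<^sup>2"
  have M: "M > 0" using norm_pos[OF J(3)] by (simp add: M_def)
  have n: "n > 0" using norm_pos[OF x] norm_pos[OF J(3)] by (simp add: n_def)
  have \<sigma>n: "\<sigma> = n * sin (\<theta> t - \<theta> x)"
    unfolding \<sigma>_def n_def sin_diff
    by (subst c0_polar[OF x], subst s0_polar[OF x], subst c0_polar[OF J(3)], subst s0_polar[OF J(3)])
       (simp add: algebra_simps)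
  have \<tau>n: "\<tau> = n * cos (\<theta> t - \<theta> x)"
    unfolding \<tau>_def n_def cos_diff
    by (subst c0_polar[OF x], subst s0_polar[OF x], subst c0_polar[OF J(3)], subst s0_polar[OF J(3)])
       (simp add: algebra_simps)
  have "\<sigma>\<^sup>2 + \<tau>\<^sup>2 = n\<^sup>2 * ((sin (\<theta> t - \<theta> x))\<^sup>2 + (cos (\<theta> t - \<theta> x))\<^sup>2)"
    unfolding \<sigma>n \<tau>n by algebra
  then have nn: "\<sigma>\<^sup>2 + \<tau>\<^sup>2 > 0" using n by simp
  \<comment> \<open>\<open>\<sigma>\<close> and \<open>\<tau>\<close> are a common positive multiple
    of the sine and cosine of the angle difference, so \<open>Y\<close> has to be expressed through
    them; the Wronskian at \<open>t\<close> makes the coefficient of \<open>\<tau>\<close> equal to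
    1.\<close>
  have Y: "M * Y x = slope * \<sigma> + \<tau>"
  proof -
    have "M * Y x = slope * \<sigma> + \<tau> * (c0 t * s1 t - s0 t * c1 t)"
      unfolding M_def Y_def slope_def \<sigma>_def \<tau>_def by (simp add: algebra_simps power2_eq_square)
    then show ?thesis using wronskian[OF J(3)] by simp
  qed
  have "Re (Z \<epsilon> x * cis (- phase x)) = \<sigma> * sin (\<theta> t - \<theta> x) + \<epsilon> * Y x * cos (\<theta> t - \<theta> x)"
    by (simp add: Z_def phase_def \<sigma>_def cos_diff sin_diff)
  then have "M * (n * Re (Z \<epsilon> x * cis (- phase x)))
      = M * (\<sigma> * (n * sin (\<theta> t - \<theta> x))) + \<epsilon> * (M * Y x) * (n * cos (\<theta> t - \<theta> x))"
    by (simp add: algebra_simps)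
  also have "\<dots> = M * \<sigma>\<^sup>2 + \<epsilon> * (M * Y x) * \<tau>"
    unfolding \<sigma>n[symmetric] \<tau>n[symmetric] by (simp add: power2_eq_square)
  also have "\<dots> = M * \<sigma>\<^sup>2 + \<epsilon> * (slope * \<sigma> * \<tau> + \<tau>\<^sup>2)"
    unfolding Y by (simp add: algebra_simps power2_eq_square)
  also have "\<dots> > 0"
  proof (cases "\<tau> = 0")
    case True
    then show ?thesis using nn M by simp
  next
    case False
    have eps: "\<epsilon> > 0" "\<epsilon> * slope\<^sup>2 \<le> M" using assms(1) by (auto simp: small_def M_def)
    \<comment> \<open>Completing the square in \<open>\<tau> / 2\<close> leaves
      \<open>3 / 4 * \<tau>\<^sup>2\<close>; the surplus
      \<open>\<epsilon> * slope\<^sup>2 * \<sigma>\<^sup>2\<close> is what \<open>small\<close>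
      allows \<open>M * \<sigma>\<^sup>2\<close> to absorb.\<close>
    have "0 < \<epsilon> * ((slope * \<sigma> + \<tau> / 2)\<^sup>2 + 3 / 4 * \<tau>\<^sup>2)"
      using eps(1) False by (intro mult_pos_pos add_nonneg_pos) auto
    also have "\<dots> = \<epsilon> * slope\<^sup>2 * \<sigma>\<^sup>2 + \<epsilon> * (slope * \<sigma> * \<tau> + \<tau>\<^sup>2)"
      by (simp add: field_simps power2_eq_square)
    also have "\<dots> \<le> M * \<sigma>\<^sup>2 + \<epsilon> * (slope * \<sigma> * \<tau> + \<tau>\<^sup>2)"
      using eps(2) by (intro add_right_mono mult_right_mono) auto
    finally show ?thesis .
  qed
  finally show ?thesis
    using M n by (simp add: zero_less_mult_iff)
qed

lemma Zroot_square: "(Zroot \<epsilon> x)\<^sup>2 = Z \<epsilon> x"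
proof -
  have "(Zroot \<epsilon> x)\<^sup>2 = (cis (phase x / 2) * cis (phase x / 2)) * (Z \<epsilon> x * cis (- phase x))"
    by (simp add: Zroot_def power_mult_distrib power2_eq_square[of "cis _"])
  also have "\<dots> = Z \<epsilon> x * (cis (phase x) * cis (- phase x))"
    by (simp add: cis_mult)
  finally show ?thesis by (simp add: cis_mult)
qed

lemma Z_nonzero: "small \<epsilon> \<Longrightarrow> x \<in> J \<Longrightarrow> Z \<epsilon> x \<noteq> 0"
  using Re_Z_rotated_pos[of \<epsilon> x] by auto

lemma Z_deriv: "x \<in> J \<Longrightarrow> (Z \<epsilon> has_vector_derivative Z1 \<epsilon> x) (at x)"
  and Z1_deriv: "x \<in> J \<Longrightarrow> (Z1 \<epsilon> has_vector_derivative - \<kappa> x * Z \<epsilon> x) (at x)"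
  and Y_deriv: "x \<in> J \<Longrightarrow> (Y has_real_derivative s1 t * c1 x - c1 t * s1 x) (at x)"
proof -
  assume x: "x \<in> J"
  show Y: "(Y has_real_derivative s1 t * c1 x - c1 t * s1 x) (at x)"
    unfolding Y_def[abs_def] using x by (auto intro!: derivative_eq_intros c0_deriv s0_deriv)
  have "((\<lambda>x. s0 t * c0 x - c0 t * s0 x) has_real_derivative s0 t * c1 x - c0 t * s1 x) (at x)"
    using x by (auto intro!: derivative_eq_intros c0_deriv s0_deriv)
  moreover have "((\<lambda>x. - \<epsilon> * Y x) has_real_derivative - \<epsilon> * (s1 t * c1 x - c1 t * s1 x)) (at x)"
    using Y by (rule DERIV_cmult)
  ultimately show "(Z \<epsilon> has_vector_derivative Z1 \<epsilon> x) (at x)"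
    unfolding Z_def[abs_def] Z1_def has_vector_derivative_complex_iff
    by (simp add: has_real_derivative_iff_has_vector_derivative)
  have "((\<lambda>x. s0 t * c1 x - c0 t * s1 x) has_real_derivative - \<kappa> x * (s0 t * c0 x - c0 t * s0 x)) (at x)"
    using x by (auto intro!: derivative_eq_intros c1_deriv s1_deriv simp: algebra_simps)
  moreover have "((\<lambda>x. - \<epsilon> * (s1 t * c1 x - c1 t * s1 x)) has_real_derivative - \<kappa> x * (- \<epsilon> * Y x)) (at x)"
    using x by (auto intro!: derivative_eq_intros c1_deriv s1_deriv simp: algebra_simps Y_def)
  ultimately show "(Z1 \<epsilon> has_vector_derivative - \<kappa> x * Z \<epsilon> x) (at x)"
    unfolding Z_def Z1_def[abs_def] has_vector_derivative_complex_iff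
    by (simp add: has_real_derivative_iff_has_vector_derivative)
qed

text \<open>The explicit formula with \<open>csqrt\<close> is used only for differentiability. The
  value of the derivative follows by differentiating \<open>Zroot * Zroot = Z\<close>, so the
  derivative of \<open>phase\<close> never enters.\<close>

lemma Zroot_deriv:
  assumes "small \<epsilon>" and x: "x \<in> J"
  shows "(Zroot \<epsilon> has_vector_derivative Z1 \<epsilon> x / (2 * Zroot \<epsilon> x)) (at x)"
proof -
  have ph: "(phase has_real_derivative - (1 / ((c0 x)\<^sup>2 + (s0 x)\<^sup>2))) (at x)"
    unfolding phase_def[abs_def] using x by (auto intro!: derivative_eq_intros \<theta>_deriv)
  obtain D1 where D1: "((\<lambda>x. cis (phase x / 2)) has_vector_derivative D1) (at x)"
    using cis_has_vector_derivative[OF DERIV_cdivide[OF ph]] by blast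
  obtain D2 where D2: "((\<lambda>x. cis (- phase x)) has_vector_derivative D2) (at x)"
    using cis_has_vector_derivative[OF DERIV_minus[OF ph]] by blast
  have W: "((\<lambda>x. Z \<epsilon> x * cis (- phase x)) has_vector_derivative
      Z \<epsilon> x * D2 + Z1 \<epsilon> x * cis (- phase x)) (at x)"
    by (rule has_vector_derivative_mult[OF Z_deriv[OF x] D2])
  have "Z \<epsilon> x * cis (- phase x) \<notin> \<real>\<^sub>\<le>\<^sub>0"
    using Re_Z_rotated_pos[OF assms] by (auto simp: complex_nonpos_Reals_iff)
  from field_vector_diff_chain_at[OF W has_field_derivative_csqrt[OF this]]
  obtain D3 where D3: "((\<lambda>x. csqrt (Z \<epsilon> x * cis (- phase x))) has_vector_derivative D3) (at x)"
    unfolding comp_def by blast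
  obtain D where D: "(Zroot \<epsilon> has_vector_derivative D) (at x)"
    using has_vector_derivative_mult[OF D1 D3] unfolding Zroot_def[abs_def] by blast
  have "((\<lambda>x. Zroot \<epsilon> x * Zroot \<epsilon> x) has_vector_derivative Zroot \<epsilon> x * D + D * Zroot \<epsilon> x) (at x)"
    by (rule has_vector_derivative_mult[OF D D])
  then have "(Z \<epsilon> has_vector_derivative Zroot \<epsilon> x * D + D * Zroot \<epsilon> x) (at x)"
    using Zroot_square by (simp add: power2_eq_square fun_eq_iff)
  then have "Zroot \<epsilon> x * D + D * Zroot \<epsilon> x = Z1 \<epsilon> x"
    using Z_deriv[OF x] vector_derivative_unique_at by blast
  moreover have "Zroot \<epsilon> x \<noteq> 0"
    using Zroot_square[of \<epsilon> x] Z_nonzero[OF assms] by auto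
  ultimately have "D = Z1 \<epsilon> x / (2 * Zroot \<epsilon> x)"
    by (simp add: field_simps)
  with D show ?thesis by simp
qed

text \<open>A Wronskian of two combinations of \<open>c0\<close> and \<open>s0\<close> is the
  determinant of their coefficients times the Wronskian of the pair, and both factors are 1. The
  imaginary part of \<open>Z\<close> is a multiple of \<open>Y\<close> and contributes
  nothing.\<close>

lemma wronskian_Z: "x \<in> J \<Longrightarrow> (s1 t * c1 x - c1 t * s1 x) * Z \<epsilon> x - Y x * Z1 \<epsilon> x = 1"
proof -
  assume x: "x \<in> J"
  have "(s1 t * c1 x - c1 t * s1 x) * (s0 t * c0 x - c0 t * s0 x) - Y x * (s0 t * c1 x - c0 t * s1 x)
     = (c0 t * s1 t - s0 t * c1 t) * (c0 x * s1 x - s0 x * c1 x)"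
    unfolding Y_def by (simp add: algebra_simps)
  then have "(s1 t * c1 x - c1 t * s1 x) * (s0 t * c0 x - c0 t * s0 x) - Y x * (s0 t * c1 x - c0 t * s1 x) = 1"
    using wronskian[OF J(3)] wronskian[OF x] by simp
  then show ?thesis
    by (simp add: complex_eq_iff Z_def Z1_def)
qed

text \<open>The logarithmic derivative of an oscillator solution linearizes the Riccati equation for
  the quadratic coefficient. The other coefficients follow by integration: the linear one is a
  multiple of \<open>1 / Z\<close>, and the constant one of \<open>Y / Z\<close>, whose derivative
  is \<open>1 / Z\<^sup>2\<close> by the Wronskian. The constants are chosen so that the exponent at
  \<open>t\<close> is \<open>- (q - a)\<^sup>2 / (2 * \<epsilon>)\<close>. Decay holds at all times
  because the imaginary part of \<open>Z1 / Z\<close> is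
  \<open>- \<epsilon> / (cmod Z)\<^sup>2\<close>.\<close>

lemma riccati:
  fixes a :: real
  assumes "small \<epsilon>"
  shows "riccati_gaussian J \<kappa> (\<lambda>x. - \<i> / 2 * (Z1 \<epsilon> x / Z \<epsilon> x)) (\<lambda>x. - \<i> * a / Z \<epsilon> x)
    (\<lambda>x. \<i> * a\<^sup>2 / 2 * (Y x / Z \<epsilon> x)) (\<lambda>x. 1 / Zroot \<epsilon> x)"
proof
  show "open J" "continuous_on J \<kappa>" by (rule J \<kappa>_cont)+
  fix x assume x: "x \<in> J"
  have nz: "Z \<epsilon> x \<noteq> 0" by (rule Z_nonzero[OF assms x])
  have nzr: "Zroot \<epsilon> x \<noteq> 0" using Zroot_square[of \<epsilon> x] nz by auto
  note const = has_vector_derivative_const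
  show "((\<lambda>x. - \<i> / 2 * (Z1 \<epsilon> x / Z \<epsilon> x)) has_vector_derivative
      - 2 * \<i> * (- \<i> / 2 * (Z1 \<epsilon> x / Z \<epsilon> x))\<^sup>2 + \<i> * \<kappa> x / 2) (at x)"
    by (rule has_vector_derivative_eq_rhs[OF has_vector_derivative_mult_right[OF
          has_vector_derivative_divide_field[OF Z1_deriv[OF x] Z_deriv[OF x] nz]]])
       (use nz in \<open>simp add: field_simps power2_eq_square\<close>)
  show "((\<lambda>x. - \<i> * a / Z \<epsilon> x) has_vector_derivative
      - 2 * \<i> * (- \<i> / 2 * (Z1 \<epsilon> x / Z \<epsilon> x)) * (- \<i> * a / Z \<epsilon> x)) (at x)"
    by (rule has_vector_derivative_eq_rhs[OF has_vector_derivative_divide_field[OF const Z_deriv[OF x] nz]])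
       (use nz in \<open>simp add: field_simps power2_eq_square\<close>)
  have Yd: "((\<lambda>x. complex_of_real (Y x)) has_vector_derivative complex_of_real (s1 t * c1 x - c1 t * s1 x)) (at x)"
    using Y_deriv[OF x] by (intro has_vector_derivative_of_real)
       (simp add: has_real_derivative_iff_has_vector_derivative)
  have "((\<lambda>x. \<i> * a\<^sup>2 / 2 * (Y x / Z \<epsilon> x)) has_vector_derivative \<i> * a\<^sup>2 / 2 * (1 / (Z \<epsilon> x)\<^sup>2)) (at x)"
    using has_vector_derivative_mult_right[OF has_vector_derivative_divide_field[OF Yd Z_deriv[OF x] nz], of "\<i> * a\<^sup>2 / 2"]
    unfolding wronskian_Z[OF x] .
  then show "((\<lambda>x. \<i> * a\<^sup>2 / 2 * (Y x / Z \<epsilon> x)) has_vector_derivative - \<i> * (- \<i> * a / Z \<epsilon> x)\<^sup>2 / 2) (at x)"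
    by (rule has_vector_derivative_eq_rhs) (simp add: power_divide power_mult_distrib mult_ac)
  show "((\<lambda>x. 1 / Zroot \<epsilon> x) has_vector_derivative - \<i> * (- \<i> / 2 * (Z1 \<epsilon> x / Z \<epsilon> x)) * (1 / Zroot \<epsilon> x)) (at x)"
    by (rule has_vector_derivative_eq_rhs[OF has_vector_derivative_divide_field[OF const Zroot_deriv[OF assms x] nzr]])
       (use nzr in \<open>simp add: field_simps power2_eq_square flip: Zroot_square\<close>)
  have "Im (Z1 \<epsilon> x / Z \<epsilon> x) = - \<epsilon> * ((s1 t * c1 x - c1 t * s1 x) * (s0 t * c0 x - c0 t * s0 x) - Y x * (s0 t * c1 x - c0 t * s1 x)) / (cmod (Z \<epsilon> x))\<^sup>2"
    by (simp add: Im_divide cmod_power2 Z_def Z1_def algebra_simps)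
  \<comment> \<open>The Wronskian of the two real solutions is the case \<epsilon> = 0 of the
    complex identity.\<close>
  also have "(s1 t * c1 x - c1 t * s1 x) * (s0 t * c0 x - c0 t * s0 x) - Y x * (s0 t * c1 x - c0 t * s1 x) = 1"
    using wronskian_Z[OF x, of 0] by (simp add: complex_eq_iff Z_def Z1_def)
  finally have "Im (Z1 \<epsilon> x / Z \<epsilon> x) < 0"
    using assms nz by (simp add: small_def)
  moreover have "Re (- \<i> / 2 * w) = Im w / 2" for w by simp
  ultimately show "Re (- \<i> / 2 * (Z1 \<epsilon> x / Z \<epsilon> x)) < 0" by (simp only:)
qed

text \<open>The Gaussian over a common denominator, which displays the kernel inside it: at
  \<open>x = t0\<close> and for \<epsilon> tending to 0, \<open>Z\<close>, \<open>Z1\<close> and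
  \<open>Y\<close> become \<open>s0 t\<close>, \<open>- c0 t\<close> and
  \<open>s1 t\<close>.\<close>

definition packet :: "real \<Rightarrow> real \<Rightarrow> real \<Rightarrow> real \<Rightarrow> complex" where
  "packet a \<epsilon> x q = 1 / Zroot \<epsilon> x *
     exp (\<i> / (2 * Z \<epsilon> x) * (- Z1 \<epsilon> x * (complex_of_real q)\<^sup>2 - 2 * a * q + Y x * a\<^sup>2))"

lemma packet_pairing:
  assumes "small \<epsilon>"
    and "\<And>y. y \<in> J \<Longrightarrow> schwartz (u y)"
    and "\<And>x. x \<in> J \<Longrightarrow> ((\<lambda>h. L2norm (\<lambda>q. (u (x + h) q - u x q) / complex_of_real h
       + \<i> * ham \<kappa> x (u x) q)) \<longlongrightarrow> 0) (at 0)"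
  shows "(LINT q|lborel. packet a \<epsilon> t q * u t q) = (LINT q|lborel. packet a \<epsilon> t0 q * u t0 q)"
proof -
  interpret riccati_gaussian J \<kappa> "\<lambda>x. - \<i> / 2 * (Z1 \<epsilon> x / Z \<epsilon> x)" "\<lambda>x. - \<i> * a / Z \<epsilon> x"
    "\<lambda>x. \<i> * a\<^sup>2 / 2 * (Y x / Z \<epsilon> x)" "\<lambda>x. 1 / Zroot \<epsilon> x"
    by (rule riccati[OF assms(1)])
  have "gauss = packet a \<epsilon>"
  proof (intro ext)
    fix x q
    have "- \<i> / 2 * (Z1 \<epsilon> x / Z \<epsilon> x) * (complex_of_real q)\<^sup>2 + - \<i> * a / Z \<epsilon> x * q + \<i> * a\<^sup>2 / 2 * (Y x / Z \<epsilon> x)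
      = \<i> / (2 * Z \<epsilon> x) * (- Z1 \<epsilon> x * (complex_of_real q)\<^sup>2 - 2 * a * q + Y x * a\<^sup>2)"
      by (cases "Z \<epsilon> x = 0") (simp_all add: field_simps)
    then show "gauss x q = packet a \<epsilon> x q"
      unfolding gauss_def packet_def by simp
  qed
  with pairing_constant[OF J(1) assms(2,3) J(3,4)] show ?thesis by simp
qed

text \<open>Origin of the constant in the kernel: \<open>cis (pi / 4)\<close> is the inverse of the
  unit root of \<open>- \<i>\<close> selected by \<open>phase t = - pi / 2\<close>, and
  \<open>sqrt (2 * pi)\<close> normalizes the density.\<close>

lemma packet_at_t:
  assumes "small \<epsilon>"
  shows "packet a \<epsilon> t q = cis (pi / 4) * sqrt (2 * pi) * normal_density a (sqrt \<epsilon>) q"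
proof -
  have e: "\<epsilon> > 0" using assms by (simp add: small_def)
  have w: "s1 t * c0 t - c1 t * s0 t = 1" "c0 t * s1 t - s0 t * c1 t = 1" using wronskian[OF J(3)] by (auto simp: mult.commute)
  have Y: "Y t = 1" using w by (simp add: Y_def)
  have Z: "Z \<epsilon> t = - \<i> * \<epsilon>" using Y by (simp add: Z_def complex_eq_iff)
  have Z1: "Z1 \<epsilon> t = - 1" using w by (simp add: Z1_def complex_eq_iff mult.commute)
  have ph: "phase t = - (pi / 2)" by (simp add: phase_def)
  have "Zroot \<epsilon> t = cis (- (pi / 4)) * csqrt \<epsilon>"
  proof -
    have "- \<i> * complex_of_real \<epsilon> * cis (- (- (pi / 2))) = \<epsilon>" by (simp add: complex_eq_iff)
    then show ?thesis unfolding Zroot_def Z ph by simp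
  qed
  then have r: "Zroot \<epsilon> t = cis (- (pi / 4)) * sqrt \<epsilon>" using e by simp
  have "1 / Zroot \<epsilon> t = cis (pi / 4) / sqrt \<epsilon>"
    unfolding r inverse_cis_mult by simp
  moreover have "\<i> / (2 * Z \<epsilon> t) * (- Z1 \<epsilon> t * (complex_of_real q)\<^sup>2 - 2 * a * q + Y t * a\<^sup>2)
     = complex_of_real (- (q - a)\<^sup>2 / (2 * \<epsilon>))"
    unfolding Z Z1 Y using e by (simp add: field_simps power2_eq_square)
  ultimately have "packet a \<epsilon> t q = cis (pi / 4) / sqrt \<epsilon> * complex_of_real (exp (- (q - a)\<^sup>2 / (2 * \<epsilon>)))"
    unfolding packet_def by (simp only: exp_of_real)
  moreover have "normal_density a (sqrt \<epsilon>) q = 1 / (sqrt (2 * pi) * sqrt \<epsilon>) * exp (- (q - a)\<^sup>2 / (2 * \<epsilon>))"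
    using e by (simp add: normal_density_def real_sqrt_mult)
  ultimately show ?thesis by simp
qed


text \<open>A concrete sequence of admissible widths; dividing by \<open>1 + slope\<^sup>2\<close>
  secures \<open>small\<close> for every term and avoids a case distinction on
  \<open>slope = 0\<close>.\<close>

definition step :: "nat \<Rightarrow> real" where
  "step n = ((c0 t)\<^sup>2 + (s0 t)\<^sup>2) / (1 + slope\<^sup>2) / (real n + 1)"

lemma step_pos: "step n > 0"
  using norm_pos[OF J(3)] unfolding step_def by (intro divide_pos_pos) (auto simp: add_pos_nonneg)

lemma small_step: "small (step n)"
proof -
  have M: "(c0 t)\<^sup>2 + (s0 t)\<^sup>2 > 0" by (rule norm_pos[OF J(3)])
  have d: "1 + slope\<^sup>2 > 0" by (simp add: add_pos_nonneg)
  have "step n \<le> ((c0 t)\<^sup>2 + (s0 t)\<^sup>2) / (1 + slope\<^sup>2) / 1"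
    unfolding step_def using M d by (intro divide_left_mono divide_nonneg_pos) auto
  then have "step n * slope\<^sup>2 \<le> ((c0 t)\<^sup>2 + (s0 t)\<^sup>2) / (1 + slope\<^sup>2) * slope\<^sup>2"
    by (intro mult_right_mono) auto
  also have "\<dots> = ((c0 t)\<^sup>2 + (s0 t)\<^sup>2) * (slope\<^sup>2 / (1 + slope\<^sup>2))" by simp
  also have "\<dots> \<le> ((c0 t)\<^sup>2 + (s0 t)\<^sup>2) * 1"
    using M d by (intro mult_left_mono) auto
  finally show ?thesis using step_pos by (simp add: small_def)
qed

lemma step_tendsto: "step \<longlonglongrightarrow> 0"
proof -
  have "(\<lambda>n. 1 / (real n + 1)) \<longlonglongrightarrow> 0" by real_asymp
  from tendsto_mult_right_zero[OF this, of "((c0 t)\<^sup>2 + (s0 t)\<^sup>2) / (1 + slope\<^sup>2)"]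
  show ?thesis by (simp add: step_def[abs_def])
qed

section \<open>Limits of the packet at the initial time, regular and caustic\<close>

lemma at_t0:
  "phase t0 = \<theta> t - pi / 2" "Y t0 = s1 t"
  "Z \<epsilon> t0 = Complex (s0 t) (- \<epsilon> * s1 t)" "Z1 \<epsilon> t0 = Complex (- c0 t) (\<epsilon> * c1 t)"
  by (simp_all add: phase_def Y_def Z_def Z1_def \<theta>_t0 init)

lemma packet_pairing_tendsto:
  assumes "\<And>y. y \<in> J \<Longrightarrow> schwartz (u y)"
    and "\<And>x. x \<in> J \<Longrightarrow> ((\<lambda>h. L2norm (\<lambda>q. (u (x + h) q - u x q) / complex_of_real h
       + \<i> * ham \<kappa> x (u x) q)) \<longlongrightarrow> 0) (at 0)"
  shows "(\<lambda>n. LINT q|lborel. packet a (step n) t0 q * u t0 q) \<longlonglongrightarrow> cis (pi / 4) * sqrt (2 * pi) * u t a"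
proof -
  have S: "schwartz (u t)" using assms(1) J(3) .
  obtain B where B: "\<And>q. cmod (u t q) \<le> B"
    using fast_decay_bounded[OF schwartz_fast_decay[OF S]] by blast
  have "(\<lambda>n. LINT q|lborel. complex_of_real (normal_density a (sqrt (step n)) q) * u t q) \<longlonglongrightarrow> u t a"
    using step_pos tendsto_real_sqrt[OF step_tendsto]
    by (intro normal_density_approx_identity[OF schwartz_continuous[OF S] B]) auto
  then have "(\<lambda>n. cis (pi / 4) * sqrt (2 * pi) *
      (LINT q|lborel. complex_of_real (normal_density a (sqrt (step n)) q) * u t q))
      \<longlonglongrightarrow> cis (pi / 4) * sqrt (2 * pi) * u t a"
    by (intro tendsto_mult tendsto_const)
  moreover have "(LINT q|lborel. packet a (step n) t0 q * u t0 q) = cis (pi / 4) * sqrt (2 * pi) *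
      (LINT q|lborel. complex_of_real (normal_density a (sqrt (step n)) q) * u t q)" for n
    using packet_pairing[OF small_step[of n] assms, of a]
    by (simp add: packet_at_t[OF small_step] mult.assoc)
  ultimately show ?thesis by simp
qed

text \<open>Let \<open>k\<close> be the number of half turns contained in \<open>\<theta> t\<close>
  and \<open>\<tau>\<close> the remainder in (0, pi). The factor \<open>cis (phase t0 / 2)\<close>
  contributes the angle \<open>(\<theta> t - pi / 2) / 2\<close> and the principal root contributes
  \<open>(pi / 2 - \<tau>) / 2\<close>; the remainder cancels and \<open>k * pi / 2\<close> is
  left.\<close>

lemma Zroot_t0_tendsto:
  assumes "s0 t \<noteq> 0"
  shows "(\<lambda>n. Zroot (step n) t0) \<longlonglongrightarrow> cis (pi * \<lfloor>\<theta> t / pi\<rfloor> / 2) * sqrt \<bar>s0 t\<bar>"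
proof -
  define k where "k = real_of_int \<lfloor>\<theta> t / pi\<rfloor>"
  define \<tau> where "\<tau> = \<theta> t - k * pi"
  define e where "e = cos (k * pi)"
  define r where "r = sqrt ((c0 t)\<^sup>2 + (s0 t)\<^sup>2)"
  have r: "r > 0" using norm_pos[OF J(3)] by (simp add: r_def)
  have sk: "sin (k * pi) = 0" by (auto simp: sin_zero_iff_int2 k_def)
  then have e2: "e\<^sup>2 = 1" using sin_cos_squared_add[of "k * pi"] by (simp add: e_def)
  have S: "s0 t = r * (sin \<tau> * e)"
  proof -
    have "s0 t = r * sin (\<tau> + k * pi)"
      using s0_polar[OF J(3)] by (simp add: r_def \<tau>_def)
    then show ?thesis by (simp add: sin_add sk e_def)
  qed
  have "k \<le> \<theta> t / pi" "\<theta> t / pi < k + 1" unfolding k_def by linarith+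
  then have "0 \<le> \<tau>" "\<tau> < pi" by (auto simp: \<tau>_def field_simps)
  moreover have "\<tau> \<noteq> 0" using S assms by auto
  ultimately have \<tau>: "0 < \<tau>" "\<tau> < pi" by auto
  have absS: "\<bar>s0 t\<bar> = r * sin \<tau>"
  proof -
    have "\<bar>e\<bar> = 1" using e2 by (simp add: abs_square_eq_1)
    then show ?thesis using S r sin_gt_zero[OF \<tau>] by (simp add: abs_mult)
  qed
  \<comment> \<open>\<open>cis (k * pi)\<close> is the sign of \<open>s0 t\<close>, since the sine
    of the remainder is positive.\<close>
  have cisk: "cis (k * pi) * \<bar>s0 t\<bar> = s0 t"
    unfolding absS using S sk by (simp add: complex_eq_iff e_def mult_ac)
  let ?v = "cis ((pi / 2 - \<tau>) / 2) * complex_of_real (sqrt \<bar>s0 t\<bar>)"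
  let ?W = "s0 t * cis (- phase t0)"
  have v2: "?v\<^sup>2 = ?W"
  proof -
    have "?v\<^sup>2 = cis ((pi / 2 - \<tau>) / 2 + (pi / 2 - \<tau>) / 2) * complex_of_real ((sqrt \<bar>s0 t\<bar>)\<^sup>2)"
      by (simp only: power2_eq_square of_real_mult cis_mult[symmetric] mult_ac)
    also have "(pi / 2 - \<tau>) / 2 + (pi / 2 - \<tau>) / 2 = k * pi + - phase t0"
      by (simp add: \<tau>_def at_t0)
    also have "cis (k * pi + - phase t0) * complex_of_real ((sqrt \<bar>s0 t\<bar>)\<^sup>2)
      = (cis (k * pi) * \<bar>s0 t\<bar>) * cis (- phase t0)"
      by (simp only: cis_mult[symmetric] mult_ac real_sqrt_pow2[OF abs_ge_zero])
    finally show ?thesis unfolding cisk .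
  qed
  \<comment> \<open>The angle lies strictly between -pi/4 and pi/4, so this square root of the limit
    is the principal one.\<close>
  have "cos ((pi / 2 - \<tau>) / 2) > 0"
    using \<tau> by (intro cos_gt_zero_pi) (auto simp: field_simps)
  then have Rev: "Re ?v > 0" using assms by simp
  have csq: "csqrt ?W = ?v"
    using Rev by (intro csqrt_unique v2) auto
  \<comment> \<open>For negative \<open>s0 t\<close> the limit of \<open>Z\<close> lies on the cut
    of \<open>csqrt\<close>; only the rotation makes continuity applicable.\<close>
  have "Re ?W > 0"
  proof -
    have "Re ?W = s0 t * sin (\<theta> t)" by (simp add: at_t0 cos_diff)
    also have "\<dots> = r * (sin (\<theta> t))\<^sup>2"
      using s0_polar[OF J(3)] by (simp add: r_def power2_eq_square)
    also have "\<dots> > 0"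
      using r assms s0_polar[OF J(3)] by (metis mult_eq_0_iff mult_pos_pos zero_less_power2)
    finally show ?thesis .
  qed
  then have "isCont csqrt ?W"
    by (intro continuous_at_csqrt) (auto simp: complex_nonpos_Reals_iff)
  moreover have "(\<lambda>n. Z (step n) t0 * cis (- phase t0)) \<longlonglongrightarrow> ?W"
  proof (intro tendsto_mult tendsto_const)
    have "(\<lambda>n. Complex (s0 t) (- step n * s1 t)) \<longlonglongrightarrow> Complex (s0 t) (- 0 * s1 t)"
      by (intro tendsto_Complex tendsto_intros step_tendsto)
    then show "(\<lambda>n. Z (step n) t0) \<longlonglongrightarrow> s0 t"
      by (simp add: at_t0 complex_of_real_def)
  qed
  ultimately have "(\<lambda>n. csqrt (Z (step n) t0 * cis (- phase t0))) \<longlonglongrightarrow> ?v"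
    using isCont_tendsto_compose csq by fastforce
  then have "(\<lambda>n. Zroot (step n) t0) \<longlonglongrightarrow> cis (phase t0 / 2) * ?v"
    unfolding Zroot_def by (intro tendsto_mult tendsto_const)
  also have "cis (phase t0 / 2) * ?v = cis (phase t0 / 2 + (pi / 2 - \<tau>) / 2) * sqrt \<bar>s0 t\<bar>"
    by (simp add: cis_mult flip: mult.assoc)
  also have "phase t0 / 2 + (pi / 2 - \<tau>) / 2 = pi * k / 2"
    by (simp add: at_t0 \<tau>_def field_simps)
  finally show ?thesis by (simp add: k_def)
qed

text \<open>The real part of the exponent is a nonpositive multiple of
  \<open>(q - s1 t * a)\<^sup>2\<close>: the Wronskian reduces the coefficient of
  \<open>q\<^sup>2\<close> to 1 and so completes the square. The prefactor is controlled by
  \<open>\<bar>s0 t\<bar> \<le> cmod (Z \<epsilon> t0)\<close>. Both bounds are free of \<epsilon>,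
  as domination requires.\<close>

lemma cmod_packet_t0_le:
  assumes "small \<epsilon>" "s0 t \<noteq> 0"
  shows "cmod (packet a \<epsilon> t0 q) \<le> 1 / sqrt \<bar>s0 t\<bar>"
proof -
  have e: "\<epsilon> > 0" using assms by (simp add: small_def)
  have "(cmod (Zroot \<epsilon> t0))\<^sup>2 = cmod (Z \<epsilon> t0)"
    using Zroot_square[of \<epsilon> t0] by (metis norm_power)
  then have "cmod (Zroot \<epsilon> t0) = sqrt (cmod (Z \<epsilon> t0))"
    by (metis norm_ge_zero real_sqrt_unique)
  moreover have "\<bar>s0 t\<bar> \<le> cmod (Z \<epsilon> t0)"
    using abs_Re_le_cmod[of "Z \<epsilon> t0"] by (simp add: at_t0)
  ultimately have r: "cmod (1 / Zroot \<epsilon> t0) \<le> 1 / sqrt \<bar>s0 t\<bar>"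
    using assms(2) by (simp add: norm_divide frac_le)
  let ?w = "- Z1 \<epsilon> t0 * (complex_of_real q)\<^sup>2 - 2 * a * q + Y t0 * a\<^sup>2"
  have w: "?w = Complex (c0 t * q\<^sup>2 - 2 * a * q + s1 t * a\<^sup>2) (- \<epsilon> * c1 t * q\<^sup>2)"
    by (simp add: at_t0 complex_eq_iff power2_eq_square)
  have "Im (?w / Z \<epsilon> t0) = \<epsilon> * ((c0 t * s1 t - s0 t * c1 t) * q\<^sup>2 - 2 * a * q * s1 t + (s1 t)\<^sup>2 * a\<^sup>2) / ((s0 t)\<^sup>2 + (\<epsilon> * s1 t)\<^sup>2)"
    unfolding w by (simp add: Im_divide at_t0 algebra_simps power2_eq_square)
  also have "(c0 t * s1 t - s0 t * c1 t) * q\<^sup>2 - 2 * a * q * s1 t + (s1 t)\<^sup>2 * a\<^sup>2 = (q - s1 t * a)\<^sup>2"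
    unfolding wronskian[OF J(3)] by (simp add: algebra_simps power2_eq_square)
  finally have "Im (?w / Z \<epsilon> t0) \<ge> 0" using e by simp
  moreover have "\<i> / (2 * Z \<epsilon> t0) * ?w = \<i> / 2 * (?w / Z \<epsilon> t0)" by simp
  moreover have "Re (\<i> / 2 * w) = - Im w / 2" for w by simp
  ultimately have "Re (\<i> / (2 * Z \<epsilon> t0) * ?w) \<le> 0"
    by (simp only:)
  then have "cmod (exp (\<i> / (2 * Z \<epsilon> t0) * ?w)) \<le> 1" by (simp only: norm_exp_eq_Re exp_le_one_iff)
  with r have "cmod (1 / Zroot \<epsilon> t0) * cmod (exp (\<i> / (2 * Z \<epsilon> t0) * ?w)) \<le> 1 / sqrt \<bar>s0 t\<bar> * 1"
    by (intro mult_mono) auto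
  then show ?thesis unfolding packet_def norm_mult by simp
qed

lemma index_pow_s0:
  "s0 t \<noteq> 0 \<Longrightarrow> index_pow s0 (-1/2) t t0 = 1 / (cis (pi * \<lfloor>\<theta> t / pi\<rfloor> / 2) * sqrt \<bar>s0 t\<bar>)"
  unfolding index_pow_def index_fun_s0 inverse_cis_mult
  using powr_minus_half[of "\<bar>s0 t\<bar>"] by simp

lemma packet_t0_tendsto_kernel:
  assumes "s0 t \<noteq> 0" "schwartz \<psi>"
  shows "(\<lambda>n. LINT q|lborel. packet a (step n) t0 q * \<psi> q) \<longlonglongrightarrow>
    (LINT q|lborel. index_pow s0 (-1/2) t t0 *
      exp (\<i> / complex_of_real (2 * s0 t) * complex_of_real (s1 t * a\<^sup>2 + c0 t * q\<^sup>2 - 2 * a * q)) * \<psi> q)"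
proof (rule integral_dominated_convergence[where w = "\<lambda>q. 1 / sqrt \<bar>s0 t\<bar> * cmod (\<psi> q)"])
  have [measurable]: "\<psi> \<in> borel_measurable borel"
    using schwartz_continuous[OF assms(2)] by (rule borel_measurable_continuous_onI)
  have [measurable]: "packet a \<epsilon> t0 \<in> borel_measurable borel" for \<epsilon>
    unfolding packet_def[abs_def] by (intro borel_measurable_continuous_onI continuous_intros)
  show "(\<lambda>q. packet a (step n) t0 q * \<psi> q) \<in> borel_measurable lborel" for n by measurable
  show "(\<lambda>q. index_pow s0 (-1/2) t t0 *
      exp (\<i> / complex_of_real (2 * s0 t) * complex_of_real (s1 t * a\<^sup>2 + c0 t * q\<^sup>2 - 2 * a * q)) * \<psi> q)
      \<in> borel_measurable lborel"
    by measurable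
  show "integrable lborel (\<lambda>q. 1 / sqrt \<bar>s0 t\<bar> * cmod (\<psi> q))"
    by (intro integrable_mult_right integrable_norm fast_decay_integrable schwartz_fast_decay assms)
  show "AE q in lborel. cmod (packet a (step n) t0 q * \<psi> q) \<le> 1 / sqrt \<bar>s0 t\<bar> * cmod (\<psi> q)" for n
    unfolding norm_mult by (intro AE_I2 mult_right_mono cmod_packet_t0_le small_step assms) auto
  show "AE q in lborel. (\<lambda>n. packet a (step n) t0 q * \<psi> q) \<longlonglongrightarrow> index_pow s0 (-1/2) t t0 *
      exp (\<i> / complex_of_real (2 * s0 t) * complex_of_real (s1 t * a\<^sup>2 + c0 t * q\<^sup>2 - 2 * a * q)) * \<psi> q"
  proof (intro AE_I2)
    fix q
    have "(\<lambda>n. Complex (s0 t) (- step n * s1 t)) \<longlonglongrightarrow> Complex (s0 t) (- 0 * s1 t)"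
      by (intro tendsto_Complex tendsto_intros step_tendsto)
    then have Z: "(\<lambda>n. Z (step n) t0) \<longlonglongrightarrow> s0 t"
      by (simp add: at_t0 complex_of_real_def)
    have "(\<lambda>n. Complex (- c0 t) (step n * c1 t)) \<longlonglongrightarrow> Complex (- c0 t) (0 * c1 t)"
      by (intro tendsto_Complex tendsto_intros step_tendsto)
    then have Z1: "(\<lambda>n. Z1 (step n) t0) \<longlonglongrightarrow> - c0 t"
      by (simp add: at_t0 complex_of_real_def)
    have "(\<lambda>n. packet a (step n) t0 q * \<psi> q) \<longlonglongrightarrow>
      1 / (cis (pi * \<lfloor>\<theta> t / pi\<rfloor> / 2) * sqrt \<bar>s0 t\<bar>) *
      exp (\<i> / (2 * complex_of_real (s0 t)) * (- complex_of_real (- c0 t) * (complex_of_real q)\<^sup>2 - 2 * a * q + Y t0 * a\<^sup>2)) * \<psi> q"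
      unfolding packet_def using assms(1)
      by (intro tendsto_intros Z Z1 Zroot_t0_tendsto) auto
    then show "(\<lambda>n. packet a (step n) t0 q * \<psi> q) \<longlonglongrightarrow> index_pow s0 (-1/2) t t0 *
      exp (\<i> / complex_of_real (2 * s0 t) * complex_of_real (s1 t * a\<^sup>2 + c0 t * q\<^sup>2 - 2 * a * q)) * \<psi> q"
      unfolding index_pow_s0[OF assms(1)] by (simp add: at_t0 algebra_simps)
  qed
qed

text \<open>Here \<open>Z \<epsilon> t0\<close> is purely imaginary, so the packet is an exact
  multiple of a normal density times a quadratic phase even before the limit: refocused at
  \<open>a / c0 t\<close>, with its width divided by \<open>\<bar>c0 t\<bar>\<close>.\<close>

lemma packet_t0_caustic:
  assumes "s0 t = 0" "small \<epsilon>"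
  shows "packet a \<epsilon> t0 q = cis (pi / 4) * sqrt (2 * pi) * index_pow c0 (-1/2) t t0 *
    (normal_density (a / c0 t) (sqrt \<epsilon> / \<bar>c0 t\<bar>) q * exp (\<i> * complex_of_real (c0 t * c1 t / 2 * q\<^sup>2)))"
proof -
  define C where "C = c0 t"
  have e: "\<epsilon> > 0" using assms by (simp add: small_def)
  have CS: "C * s1 t = 1" using wronskian[OF J(3)] assms(1) by (simp add: C_def)
  then have C: "C \<noteq> 0" by auto
  then have s1t: "s1 t = 1 / C" using CS by (simp add: field_simps)
  have "sin (\<theta> t) = 0"
    using s0_polar[OF J(3)] norm_pos[OF J(3)] assms(1)
    by (metis mult_eq_0_iff order_less_irrefl real_sqrt_eq_zero_cancel_iff)
  then obtain k where k: "\<theta> t = of_int k * pi" by (auto simp: sin_zero_iff_int2)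
  define d where "d = cos (\<theta> t)"
  have d2: "d\<^sup>2 = 1" using sin_cos_squared_add[of "\<theta> t"] \<open>sin (\<theta> t) = 0\<close> by (simp add: d_def)
  then have dabs: "\<bar>d\<bar> = 1" by (simp add: abs_square_eq_1)
  \<comment> \<open>\<open>d\<close> is 1 or -1 by the vanishing sine, and the polar form identifies
    it as the sign of \<open>C\<close>.\<close>
  have Cd: "C = \<bar>C\<bar> * d"
  proof -
    have "C = \<bar>C\<bar> * d \<or> C = - (\<bar>C\<bar> * d)" using dabs by (auto simp: abs_if split: if_splits)
    moreover have "C * d > 0"
    proof -
      have "C * d = sqrt ((c0 t)\<^sup>2 + (s0 t)\<^sup>2) * d\<^sup>2"
        using c0_polar[OF J(3)] by (simp add: C_def d_def power2_eq_square)
      then show ?thesis using d2 norm_pos[OF J(3)] by simp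
    qed
    ultimately show ?thesis using dabs by (auto simp: abs_if zero_less_mult_iff split: if_splits)
  qed
  \<comment> \<open>Zeros of \<open>c0\<close> lie halfway between the multiples of pi, so at
    \<open>\<theta> t = k * pi\<close> the floor of \<open>k + 1 / 2\<close> counts exactly
    \<open>k\<close> of them, with sign.\<close>
  have "index_fun c0 t t0 = \<lfloor>of_int k + 1 / 2 :: real\<rfloor>" by (simp add: index_fun_c0 k)
  also have "\<dots> = k" by linarith
  finally have "index_pow c0 (-1/2) t t0 = cis (- (pi * k / 2)) * complex_of_real (\<bar>C\<bar> powr (-1/2))"
    by (simp add: index_pow_def C_def mult_ac)
  also have "\<bar>C\<bar> powr (-1/2) = 1 / sqrt \<bar>C\<bar>"
    using C by (intro powr_minus_half) simp
  finally have ip: "index_pow c0 (-1/2) t t0 = cis (- (pi * k / 2)) / sqrt \<bar>C\<bar>" by simp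
  have "Z \<epsilon> t0 * cis (- phase t0) = complex_of_real (\<epsilon> / \<bar>C\<bar>)"
  proof -
    have "cis (- phase t0) = \<i> * d"
      by (simp add: at_t0 complex_eq_iff cos_diff sin_diff \<open>sin (\<theta> t) = 0\<close> d_def)
    moreover have "d / C = 1 / \<bar>C\<bar>"
      using Cd C d2 by (simp add: field_simps power2_eq_square)
    ultimately show ?thesis
      by (simp add: at_t0 complex_eq_iff assms(1) s1t) (metis mult.right_neutral times_divide_eq_right)
  qed
  then have "Zroot \<epsilon> t0 = cis (phase t0 / 2) * complex_of_real (sqrt (\<epsilon> / \<bar>C\<bar>))"
    unfolding Zroot_def using e by simp
  also have "phase t0 / 2 = - (pi / 4 - pi * k / 2)" by (simp add: at_t0 k field_simps)
  finally have r: "1 / Zroot \<epsilon> t0 = cis (pi / 4 - pi * k / 2) / sqrt (\<epsilon> / \<bar>C\<bar>)"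
    by (simp only: inverse_cis_mult minus_minus)
  have "\<i> / (2 * Z \<epsilon> t0) * (- Z1 \<epsilon> t0 * (complex_of_real q)\<^sup>2 - 2 * a * q + Y t0 * a\<^sup>2)
     = \<i> * complex_of_real (C * c1 t / 2 * q\<^sup>2) + complex_of_real (- (q - a / C)\<^sup>2 / (2 * (\<epsilon> / C\<^sup>2)))"
  proof -
    have "Z \<epsilon> t0 = - \<i> * (\<epsilon> / C)" by (simp add: at_t0 complex_eq_iff assms(1) s1t)
    then have "\<i> / (2 * Z \<epsilon> t0) = complex_of_real (- C / (2 * \<epsilon>))"
      using C e by simp
    moreover have "- Z1 \<epsilon> t0 * (complex_of_real q)\<^sup>2 - 2 * a * q + Y t0 * a\<^sup>2
        = complex_of_real (C * q\<^sup>2 - 2 * a * q + a\<^sup>2 / C) - \<i> * complex_of_real (\<epsilon> * c1 t * q\<^sup>2)"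
      by (simp add: at_t0 s1t complex_eq_iff C_def power2_eq_square)
    moreover have "- C / (2 * \<epsilon>) * (C * q\<^sup>2 - 2 * a * q + a\<^sup>2 / C) = - (q - a / C)\<^sup>2 / (2 * (\<epsilon> / C\<^sup>2))"
      using C e by (simp add: field_simps power2_eq_square)
    moreover have "- C / (2 * \<epsilon>) * (\<epsilon> * c1 t * q\<^sup>2) = - (C * c1 t / 2 * q\<^sup>2)"
      using e by simp
    ultimately show ?thesis
      by (simp only: right_diff_distrib mult.left_commute[of _ \<i>] of_real_mult[symmetric]) simp
  qed
  then have "packet a \<epsilon> t0 q = cis (pi / 4 - pi * k / 2) / sqrt (\<epsilon> / \<bar>C\<bar>) *
     (exp (\<i> * complex_of_real (C * c1 t / 2 * q\<^sup>2)) * complex_of_real (exp (- (q - a / C)\<^sup>2 / (2 * (\<epsilon> / C\<^sup>2)))))"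
    unfolding packet_def r by (simp only: exp_add exp_of_real)
  also have "cis (pi / 4 - pi * k / 2) = cis (pi / 4) * cis (- (pi * k / 2))"
    by (simp add: cis_mult)
  also have "exp (- (q - a / C)\<^sup>2 / (2 * (\<epsilon> / C\<^sup>2))) =
     sqrt (2 * pi) * (sqrt \<epsilon> / \<bar>C\<bar>) * normal_density (a / C) (sqrt \<epsilon> / \<bar>C\<bar>) q"
    using e C by (simp add: normal_density_def power_divide real_sqrt_mult real_sqrt_divide)
  finally have "packet a \<epsilon> t0 q = cis (pi / 4) * cis (- (pi * k / 2)) / sqrt (\<epsilon> / \<bar>C\<bar>) *
     (exp (\<i> * complex_of_real (C * c1 t / 2 * q\<^sup>2)) *
      complex_of_real (sqrt (2 * pi) * (sqrt \<epsilon> / \<bar>C\<bar>) * normal_density (a / C) (sqrt \<epsilon> / \<bar>C\<bar>) q))" .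
  moreover have "p * k / y * (E * complex_of_real (b * x * n)) =
      p * complex_of_real b * (k * (complex_of_real x / y)) * (complex_of_real n * E)" for p k y E b x n
    by simp
  ultimately have "packet a \<epsilon> t0 q = cis (pi / 4) * sqrt (2 * pi) *
      (cis (- (pi * k / 2)) * (complex_of_real (sqrt \<epsilon> / \<bar>C\<bar>) / sqrt (\<epsilon> / \<bar>C\<bar>))) *
      (normal_density (a / C) (sqrt \<epsilon> / \<bar>C\<bar>) q * exp (\<i> * complex_of_real (C * c1 t / 2 * q\<^sup>2)))"
    by (simp only:)
  \<comment> \<open>The normalization of the density gives
    \<open>sqrt \<epsilon> / \<bar>C\<bar>\<close>, the prefactor the inverse of
    \<open>sqrt (\<epsilon> / \<bar>C\<bar>)\<close>; \<epsilon> cancels and the modulus of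
    \<open>index_pow\<close> remains.\<close>
  moreover have "sqrt \<epsilon> / \<bar>C\<bar> / sqrt (\<epsilon> / \<bar>C\<bar>) = 1 / sqrt \<bar>C\<bar>"
    using e C by (simp add: real_sqrt_divide field_simps)
  then have "complex_of_real (sqrt \<epsilon> / \<bar>C\<bar>) / sqrt (\<epsilon> / \<bar>C\<bar>) = 1 / sqrt \<bar>C\<bar>"
    by (metis of_real_1 of_real_divide)
  then have "cis (- (pi * k / 2)) * (complex_of_real (sqrt \<epsilon> / \<bar>C\<bar>) / sqrt (\<epsilon> / \<bar>C\<bar>))
      = index_pow c0 (-1/2) t t0"
    unfolding ip by (simp only:) simp
  ultimately show ?thesis by (simp only: C_def)
qed

lemma packet_t0_tendsto_caustic:
  assumes "s0 t = 0" "schwartz \<psi>"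
  shows "(\<lambda>n. LINT q|lborel. packet a (step n) t0 q * \<psi> q) \<longlonglongrightarrow>
    cis (pi / 4) * sqrt (2 * pi) * (index_pow c0 (-1/2) t t0 *
      exp (\<i> * complex_of_real (c1 t / (2 * c0 t) * a\<^sup>2)) * \<psi> (a / c0 t))"
proof -
  have C: "c0 t \<noteq> 0" using wronskian[OF J(3)] assms(1) by auto
  let ?f = "\<lambda>q. exp (\<i> * complex_of_real (c0 t * c1 t / 2 * q\<^sup>2)) * \<psi> q"
  obtain B where B: "\<And>q. cmod (\<psi> q) \<le> B"
    using fast_decay_bounded[OF schwartz_fast_decay[OF assms(2)]] by blast
  have "(\<lambda>n. LINT q|lborel. complex_of_real (normal_density (a / c0 t) (sqrt (step n) / \<bar>c0 t\<bar>) q) * ?f q)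
      \<longlonglongrightarrow> ?f (a / c0 t)"
  proof (rule normal_density_approx_identity)
    show "continuous_on UNIV ?f"
      using schwartz_continuous[OF assms(2)] by (intro continuous_intros)
    show "cmod (?f q) \<le> B" for q using B[of q] by (simp add: norm_mult)
    show "sqrt (step n) / \<bar>c0 t\<bar> > 0" for n using step_pos C by simp
    have "(\<lambda>n. sqrt (step n) / \<bar>c0 t\<bar>) \<longlonglongrightarrow> sqrt 0 / \<bar>c0 t\<bar>"
      using C by (intro tendsto_intros step_tendsto) auto
    then show "(\<lambda>n. sqrt (step n) / \<bar>c0 t\<bar>) \<longlonglongrightarrow> 0" by simp
  qed
  then have "(\<lambda>n. cis (pi / 4) * sqrt (2 * pi) * index_pow c0 (-1/2) t t0 *
      (LINT q|lborel. complex_of_real (normal_density (a / c0 t) (sqrt (step n) / \<bar>c0 t\<bar>) q) * ?f q))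
      \<longlonglongrightarrow> cis (pi / 4) * sqrt (2 * pi) * index_pow c0 (-1/2) t t0 * ?f (a / c0 t)"
    by (intro tendsto_mult tendsto_const)
  moreover have "(LINT q|lborel. packet a (step n) t0 q * \<psi> q) = cis (pi / 4) * sqrt (2 * pi) * index_pow c0 (-1/2) t t0 *
      (LINT q|lborel. complex_of_real (normal_density (a / c0 t) (sqrt (step n) / \<bar>c0 t\<bar>) q) * ?f q)" for n
    unfolding packet_t0_caustic[OF assms(1) small_step]
    by (simp add: mult.assoc)
  moreover have "?f (a / c0 t) = exp (\<i> * complex_of_real (c1 t / (2 * c0 t) * a\<^sup>2)) * \<psi> (a / c0 t)"
  proof -
    have "c0 t * c1 t / 2 * (a / c0 t)\<^sup>2 = c1 t / (2 * c0 t) * a\<^sup>2"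
      using C by (simp add: field_simps power2_eq_square)
    then show ?thesis by (simp only:)
  qed
  ultimately show ?thesis by (simp only: mult.assoc)
qed

end

section \<open>The kernel formula for the propagator\<close>

theorem theoremD2p1:
  fixes I :: "real set" and \<kappa> :: "real \<Rightarrow> real"
    and c s :: "real \<Rightarrow> real \<Rightarrow> real"
    and U :: "real \<Rightarrow> real \<Rightarrow> (real \<Rightarrow> complex) \<Rightarrow> (real \<Rightarrow> complex)"
  assumes I_int: "is_interval I" and I_open: "open I" and I_ne: "I \<noteq> {}"
    and \<kappa>_cont: "continuous_on I \<kappa>"
    and cs_sol: "\<forall>\<tau>\<in>I. \<exists>c' s'. c \<tau> \<tau> = 1 \<and> c' \<tau> = 0 \<and> s \<tau> \<tau> = 0 \<and> s' \<tau> = 1 \<and>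
        (\<forall>t\<in>I. ((\<lambda>x. c x \<tau>) has_real_derivative c' t) (at t) \<and>
                (c' has_real_derivative (- \<kappa> t * c t \<tau>)) (at t) \<and>
                ((\<lambda>x. s x \<tau>) has_real_derivative s' t) (at t) \<and>
                (s' has_real_derivative (- \<kappa> t * s t \<tau>)) (at t))"
    and U_prop: "\<forall>\<tau>\<in>I. \<forall>\<phi>. schwartz \<phi> \<longrightarrow>
        U \<tau> \<tau> \<phi> = \<phi> \<and>
        (\<forall>t\<in>I. schwartz (U t \<tau> \<phi>)) \<and>
        (\<forall>t\<in>I. L2norm (U t \<tau> \<phi>) = L2norm \<phi>) \<and>
        (\<forall>t\<in>I. ((\<lambda>h. L2norm (\<lambda>q. (U (t + h) \<tau> \<phi> q - U t \<tau> \<phi> q) / complex_of_real h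
                                  + \<i> * ham \<kappa> t (U t \<tau> \<phi>) q)) \<longlongrightarrow> 0) (at 0))"
    and t_in: "t \<in> I" and t0_in: "t0 \<in> I"
    and \<psi>_S: "schwartz \<psi>"
  shows "(s t t0 \<noteq> 0 \<longrightarrow>
           (\<forall>q. U t t0 \<psi> q =
              (LINT q0|lborel.
                 (1 / (complex_of_real (sqrt (2 * pi)) * cis (pi / 4)))
                 * index_pow (\<lambda>x. s x t0) (-1/2) t t0
                 * exp (\<i> / complex_of_real (2 * s t t0)
                        * complex_of_real (c t0 t * q\<^sup>2 + c t t0 * q0\<^sup>2 - 2 * q * q0))
                 * \<psi> q0))) \<and>
         (s t t0 = 0 \<longrightarrow>
           (\<forall>q. U t t0 \<psi> q =
              index_pow (\<lambda>x. c x t0) (-1/2) t t0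
              * exp (\<i> * complex_of_real (deriv (\<lambda>x. c x t0) t / (2 * c t t0) * q\<^sup>2))
              * \<psi> (q / c t t0)))"
proof -
  obtain c1 s1 where init: "c t0 t0 = 1" "c1 t0 = 0" "s t0 t0 = 0" "s1 t0 = 1"
    and c0_deriv: "\<And>x. x \<in> I \<Longrightarrow> ((\<lambda>x. c x t0) has_real_derivative c1 x) (at x)"
    and c1_deriv: "\<And>x. x \<in> I \<Longrightarrow> (c1 has_real_derivative - \<kappa> x * c x t0) (at x)"
    and s0_deriv: "\<And>x. x \<in> I \<Longrightarrow> ((\<lambda>x. s x t0) has_real_derivative s1 x) (at x)"
    and s1_deriv: "\<And>x. x \<in> I \<Longrightarrow> (s1 has_real_derivative - \<kappa> x * s x t0) (at x)"
    using bspec[OF cs_sol t0_in] by blast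
  obtain d1 where d1: "c t t = 1" "d1 t = 0"
    "\<And>x. x \<in> I \<Longrightarrow> ((\<lambda>x. c x t) has_real_derivative d1 x) (at x)"
    "\<And>x. x \<in> I \<Longrightarrow> (d1 has_real_derivative - \<kappa> x * c x t) (at x)"
    using bspec[OF cs_sol t_in] by blast
  have wronskian: "c x t0 * s1 x - s x t0 * c1 x = 1" if "x \<in> I" for x
    using wronskian_constant[OF I_int that t0_in c0_deriv c1_deriv s0_deriv s1_deriv] init by simp
  \<comment> \<open>The Wronskian of \<open>c(.,t)\<close> and \<open>s(.,t0)\<close> is
    \<open>s1 t\<close> at time \<open>t\<close> and \<open>c t0 t\<close> at time
    \<open>t0\<close>. This turns the coefficient found in the limit into the one displayed in the
    kernel.\<close>
  have ct0: "c t0 t = s1 t"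
    using wronskian_constant[OF I_int t_in t0_in d1(3,4) s0_deriv s1_deriv] init d1(1,2) by simp
  have c1t: "deriv (\<lambda>x. c x t0) t = c1 t"
    using c0_deriv[OF t_in] by (rule DERIV_imp_deriv)

  \<comment> \<open>The angle is built by integrating over a compact interval, which must lie in
    \<open>I\<close> and contain both times in its interior.\<close>
  obtain a b where ab: "{a..b} \<subseteq> I" "t \<in> {a<..<b}" "t0 \<in> {a<..<b}"
  proof -
    obtain d where d: "d > 0" "cball t d \<subseteq> I" using I_open t_in open_contains_cball by blast
    obtain d0 where d0: "d0 > 0" "cball t0 d0 \<subseteq> I" using I_open t0_in open_contains_cball by blast
    have mem: "t - d \<in> I" "t + d \<in> I" "t0 - d0 \<in> I" "t0 + d0 \<in> I"
      using d d0 by (auto simp: subset_iff dist_real_def)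
    have "{min (t - d) (t0 - d0)..max (t + d) (t0 + d0)} \<subseteq> I"
      using I_int mem
      by (metis interval_subset_is_interval cbox_interval min_def max_def)
    moreover have "t \<in> {min (t - d) (t0 - d0)<..<max (t + d) (t0 + d0)}"
      "t0 \<in> {min (t - d) (t0 - d0)<..<max (t + d) (t0 + d0)}"
      using d(1) d0(1) by auto
    ultimately show thesis by (rule that)
  qed
  define J where "J = {a<..<b}"
  have JI: "x \<in> I" if "x \<in> J" for x using ab(1) that by (auto simp: J_def)
  obtain \<theta> where \<theta>: "\<theta> t0 = 0"
    "\<And>x. x \<in> J \<Longrightarrow> (\<theta> has_real_derivative 1 / ((c x t0)\<^sup>2 + (s x t0)\<^sup>2)) (at x)"
    "\<And>x. x \<in> J \<Longrightarrow> c x t0 = sqrt ((c x t0)\<^sup>2 + (s x t0)\<^sup>2) * cos (\<theta> x)"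
    "\<And>x. x \<in> J \<Longrightarrow> s x t0 = sqrt ((c x t0)\<^sup>2 + (s x t0)\<^sup>2) * sin (\<theta> x)"
    unfolding J_def
    using pruefer_angle[OF ab(3) c0_deriv[OF subsetD[OF ab(1)]] s0_deriv[OF subsetD[OF ab(1)]]
        wronskian[OF subsetD[OF ab(1)]] init(1,3)] by metis
  interpret pruefer_pair J \<kappa> "\<lambda>x. c x t0" c1 "\<lambda>x. s x t0" s1 \<theta> t t0
  proof
    show "is_interval J" "open J" "t \<in> J" "t0 \<in> J"
      using ab by (simp_all add: J_def)
    show "continuous_on J \<kappa>" using \<kappa>_cont JI by (meson continuous_on_subset subsetI)
  qed (fact c0_deriv[OF JI] c1_deriv[OF JI] s0_deriv[OF JI] s1_deriv[OF JI] wronskian[OF JI] init \<theta>)+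

  note U = U_prop[rule_format, OF t0_in \<psi>_S]
  \<comment> \<open>The limit common to both cases; comparing it with the limit of the packet
    itself, kernel or concentrated density, identifies \<open>U t t0 \<psi> q\<close> by uniqueness
    of limits.\<close>
  have lim: "(\<lambda>n. LINT q0|lborel. packet q (step n) t0 q0 * \<psi> q0)
      \<longlonglongrightarrow> cis (pi / 4) * sqrt (2 * pi) * U t t0 \<psi> q" for q
  proof -
    have "(\<lambda>n. LINT q0|lborel. packet q (step n) t0 q0 * U t0 t0 \<psi> q0)
      \<longlonglongrightarrow> cis (pi / 4) * sqrt (2 * pi) * U t t0 \<psi> q"
      using U JI by (intro packet_pairing_tendsto[where u = "\<lambda>x. U x t0 \<psi>"]) blast+
    then show ?thesis using U by simp
  qed
  have nz: "cis (pi / 4) * complex_of_real (sqrt (2 * pi)) \<noteq> 0" by simp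
  show ?thesis
  proof (intro conjI impI allI)
    fix q assume S: "s t t0 \<noteq> 0"
    let ?K = "\<lambda>q0. index_pow (\<lambda>x. s x t0) (-1/2) t t0 *
      exp (\<i> / complex_of_real (2 * s t t0) * complex_of_real (s1 t * q\<^sup>2 + c t t0 * q0\<^sup>2 - 2 * q * q0)) * \<psi> q0"
    have "cis (pi / 4) * sqrt (2 * pi) * U t t0 \<psi> q = (LINT q0|lborel. ?K q0)"
      using LIMSEQ_unique[OF lim packet_t0_tendsto_kernel[OF S \<psi>_S]] .
    then have "U t t0 \<psi> q = 1 / (sqrt (2 * pi) * cis (pi / 4)) * (LINT q0|lborel. ?K q0)"
      using nz by (simp add: field_simps)
    also have "\<dots> = (LINT q0|lborel. 1 / (sqrt (2 * pi) * cis (pi / 4)) * ?K q0)"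
      by (rule integral_mult_right_zero[symmetric])
    finally show "U t t0 \<psi> q = (LINT q0|lborel. (1 / (complex_of_real (sqrt (2 * pi)) * cis (pi / 4)))
                 * index_pow (\<lambda>x. s x t0) (-1/2) t t0
                 * exp (\<i> / complex_of_real (2 * s t t0)
                        * complex_of_real (c t0 t * q\<^sup>2 + c t t0 * q0\<^sup>2 - 2 * q * q0))
                 * \<psi> q0)"
      unfolding ct0 by (simp only: mult.assoc)
  next
    fix q assume S: "s t t0 = 0"
    from LIMSEQ_unique[OF lim packet_t0_tendsto_caustic[OF S \<psi>_S]] nz
    show "U t t0 \<psi> q = index_pow (\<lambda>x. c x t0) (-1/2) t t0
              * exp (\<i> * complex_of_real (deriv (\<lambda>x. c x t0) t / (2 * c t t0) * q\<^sup>2))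
              * \<psi> (q / c t t0)"
      unfolding c1t mult_cancel_left by blast
  qed
qed

end
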